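(* Consider the target system, for $t\ge0$, $x\in[0,1]$, with scalar states $\alpha,\beta$ and $\mathbb{R}^n$-valued state $v$: $$\partial_t\alpha(t,x)=-\lambda_1\partial_x\alpha(t,x),\qquad \partial_t\beta(t,x)=\lambda_2\partial_x\beta(t,x),$$ $$\partial_t v(t,x)=\Omega_1\alpha(t,x)+\Omega_2\beta(t,x)+\Psi v(t,x)+\int_x^1N_1(x,\xi)\alpha(t,\xi)d\xi+\int_x^1N_2(x,\xi)\beta(t,\xi)d\xi+\int_x^1N_3(x,\xi)v(t,\xi)d\xi,$$ $$\beta(t,1)=\rho\,\alpha(t,1),\qquad \alpha(t,0)=0,$$ where $\Psi$ is a Hurwitz matrix, $N_j(x,\xi)=\Omega_1L_j(x,\xi)+\Omega_2M_j(x,\xi)$ for $j\in\{1,2\}$ and $N_3(x,\xi)=\Omega_1S(x,\xi)+\Omega_2E(x,\xi)$. Then the zero equilibrium $\alpha\equiv\beta\equiv v\equiv0$ of this system is exponentially stable in the $\mathcal{L}^2$ sense.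
   Context: Setting: $n\ge1$ is an integer; $\lambda_1,\lambda_2>0$; $\rho,q$ are nonzero real numbers; $\sigma_{12},\sigma_{21}\in\mathbb{R}$; $\Theta_1,\Theta_2\in\mathbb{R}^{1\times n}$ (row vectors); $\Omega_1,\Omega_2\in\mathbb{R}^{n}$ (column vectors); $\Psi\in\mathbb{R}^{n\times n}$ is Hurwitz. Exponential stability in the $\mathcal{L}^2$ sense means: there exist constants $C,c>0$ such that for all initial data in $\mathcal{L}^2(0,1)\times\mathcal{L}^2(0,1)\times(\mathcal{L}^2(0,1))^n$ the solution satisfies $\|\alpha[t]\|_2+\|\beta[t]\|_2+\|v[t]\|_2\le C\mathrm{e}^{-ct}\left(\|\alpha[0]\|_2+\|\beta[0]\|_2+\|v[0]\|_2\right)$ for all $t\ge0$, where $f[t]$ denotes the profile $x\mapsto f(t,x)$ and $\|\cdot\|_2$ is the $\mathcal{L}^2(0,1)$ norm. Kernels: on the triangle $\mathcal{T}=\{(x,\xi)\in\mathbb{R}^2:0\le x\le\xi\le1\}$, $K_1,K_2,Q_1,Q_2$ (scalar, $\mathcal{C}^1(\mathcal{T})$) and $G,R$ ($\mathbb{R}^{1\times n}$-valued) are the solution of $$\lambda_1\partial_xK_1+\lambda_1\partial_\xi K_1=-\sigma_{21}K_2-G\Omega_1,\qquad \lambda_1\partial_xK_2-\lambda_2\partial_\xi K_2=-\sigma_{12}K_1-G\Omega_2,$$ $$\lambda_1\partial_xG=-K_1\Theta_1-K_2\Theta_2-G\Psi,$$ $$\lambda_2\partial_xQ_1-\lambda_1\partial_\xi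 Q_1=\sigma_{21}Q_2+R\Omega_1,\qquad \lambda_2\partial_xQ_2+\lambda_2\partial_\xi Q_2=\sigma_{12}Q_1+R\Omega_2,$$ $$\lambda_2\partial_xR=Q_1\Theta_1+Q_2\Theta_2+R\Psi,$$ with boundary conditions $$K_1(x,1)=\frac{\lambda_2\rho}{\lambda_1}K_2(x,1),\quad K_2(x,x)=-\frac{\sigma_{12}}{\lambda_1+\lambda_2},\quad G(x,x)=-\frac{\Theta_1}{\lambda_1},$$ $$Q_1(x,x)=\frac{\sigma_{21}}{\lambda_1+\lambda_2},\quad Q_2(x,1)=\frac{\lambda_1}{\lambda_2\rho}Q_1(x,1),\quad R(x,x)=\frac{\Theta_2}{\lambda_2}.$$ Inverse kernels: consider the Volterra transformation $(u,p,v)\mapsto(\alpha,\beta,v)$ given by $$\alpha(x)=u(x)-\int_x^1K_1(x,\xi)u(\xi)d\xi-\int_x^1K_2(x,\xi)p(\xi)d\xi-\int_x^1G(x,\xi)v(\xi)d\xi,$$ $$\beta(x)=p(x)-\int_x^1Q_1(x,\xi)u(\xi)d\xi-\int_x^1Q_2(x,\xi)p(\xi)d\xi-\int_x^1R(x,\xi)v(\xi)d\xi.$$ $L_1,L_2,M_1,M_2$ (scalar) and $S,E$ ($\mathbb{R}^{1\times n}$-valued), defined on $\mathcal{T}$ and bounded, are the kernels of its inverse: $$u(x)=\alpha(x)+\int_x^1L_1(x,\xi)\alpha(\xi)d\xi+\int_x^1L_2(x,\xi)\beta(\xi)d\xi+\int_x^1S(x,\xi)v(\xi)d\xi,$$ $$p(x)=\beta(x)+\int_x^1M_1(x,\xi)\alpha(\xi)d\xi+\int_x^1M_2(x,\xi)\beta(\xi)d\xi+\int_x^1E(x,\xi)v(\xi)d\xi.$$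 *)

theory Defs
  imports "HOL-Analysis.Analysis"
begin

text \<open>Row vectors in $\mathbb{R}^{1\times n}$ and column vectors in $\mathbb{R}^n$ both have type
  \<^typ>\<open>real^'n\<close>. A row times a column is the inner product \<open>\<bullet>\<close>, a row times a matrix is
  \<open>v*\<close>, a matrix times a column is \<open>*v\<close>, and a column times a row is \<open>outer\<close>.\<close>

definition outer :: "real^'n \<Rightarrow> real^'n \<Rightarrow> real^'n^'n" where
  "outer a b = (\<chi> i j. a $ i * b $ j)"

definition hurwitz :: "real^'n^'n \<Rightarrow> bool" where
  "hurwitz A \<longleftrightarrow>
     (\<forall>(\<mu>::complex) (w::complex^'n).
        w \<noteq> 0 \<and> map_matrix complex_of_real A *v w = \<mu> *s w \<longrightarrow> Re \<mu> < 0)"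


subsection \<open>Functions\<close>

text \<open>Elements of $L^2(0,1)$ are represented by Lebesgue measurable functions; equality of two
  elements is equality almost everywhere on \<open>{0..1}\<close>, and the values outside \<open>{0..1}\<close> are
  irrelevant.\<close>

definition in_L2 :: "(real \<Rightarrow> 'b::euclidean_space) \<Rightarrow> bool" where
  "in_L2 f \<longleftrightarrow> set_borel_measurable lebesgue {0..1} f \<and>
                set_integrable lebesgue {0..1} (\<lambda>x. (norm (f x))\<^sup>2)"

definition L2norm :: "(real \<Rightarrow> 'b::euclidean_space) \<Rightarrow> real" where
  "L2norm f = sqrt (LINT x:{0..1}|lebesgue. (norm (f x))\<^sup>2)"

text \<open>\<open>f \<in> C\<^sup>0([0,\<infinity>); L\<^sup>2(0,1))\<close>; the profile at time \<open>t\<close> is \<open>f t\<close>.\<close>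

definition L2_path :: "(real \<Rightarrow> real \<Rightarrow> 'b::euclidean_space) \<Rightarrow> bool" where
  "L2_path f \<longleftrightarrow> (\<forall>t\<ge>0. in_L2 (f t) \<and>
     ((\<lambda>s. L2norm (\<lambda>x. f s x - f t x)) \<longlongrightarrow> 0) (at t within {0..}))"

text \<open>\<open>f\<close> is continuously differentiable on \<open>D\<close> (up to the boundary), with partial derivatives
  \<open>f1\<close> and \<open>f2\<close> with respect to the first and the second argument.\<close>

definition C1_with_partials ::
    "(real \<times> real) set \<Rightarrow> (real \<Rightarrow> real \<Rightarrow> 'b::real_normed_vector) \<Rightarrow>
     (real \<Rightarrow> real \<Rightarrow> 'b) \<Rightarrow> (real \<Rightarrow> real \<Rightarrow> 'b) \<Rightarrow> bool" where
  "C1_with_partials D f f1 f2 \<longleftrightarrow>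
     continuous_on D (\<lambda>(x, y). f1 x y) \<and> continuous_on D (\<lambda>(x, y). f2 x y) \<and>
     (\<forall>(x, y)\<in>D. ((\<lambda>(x, y). f x y) has_derivative
        (\<lambda>(h, k). h *\<^sub>R f1 x y + k *\<^sub>R f2 x y)) (at (x, y) within D))"


subsection \<open>Kernels\<close>

definition kernel_domain :: "(real \<times> real) set" where
  "kernel_domain = {(x, \<xi>). 0 \<le> x \<and> x \<le> \<xi> \<and> \<xi> \<le> 1}"

text \<open>The suffixes \<open>x\<close> and \<open>\<xi>\<close> denote partial derivatives. The equations for the row-vector
  kernels \<open>G\<close> and \<open>R\<close> only involve the derivative in \<open>x\<close>, so only that derivative is required to
  exist (together with joint continuity).\<close>

definition backstepping_kernels ::
    "real \<Rightarrow> real \<Rightarrow> real \<Rightarrow> real \<Rightarrow> real \<Rightarrow> real^'n \<Rightarrow> real^'n \<Rightarrow> real^'n \<Rightarrow> real^'n \<Rightarrow> real^'n^'n \<Rightarrow>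
     (real \<Rightarrow> real \<Rightarrow> real) \<Rightarrow> (real \<Rightarrow> real \<Rightarrow> real) \<Rightarrow> (real \<Rightarrow> real \<Rightarrow> real^'n) \<Rightarrow>
     (real \<Rightarrow> real \<Rightarrow> real) \<Rightarrow> (real \<Rightarrow> real \<Rightarrow> real) \<Rightarrow> (real \<Rightarrow> real \<Rightarrow> real^'n) \<Rightarrow> bool" where
  "backstepping_kernels lam1 lam2 \<rho> \<sigma>12 \<sigma>21 \<Theta>1 \<Theta>2 \<Omega>1 \<Omega>2 \<Psi> K1 K2 G Q1 Q2 R \<longleftrightarrow>
     (\<exists>K1x K1\<xi> K2x K2\<xi> Q1x Q1\<xi> Q2x Q2\<xi> Gx Rx.
        C1_with_partials kernel_domain K1 K1x K1\<xi> \<and> C1_with_partials kernel_domain K2 K2x K2\<xi> \<and>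
        C1_with_partials kernel_domain Q1 Q1x Q1\<xi> \<and> C1_with_partials kernel_domain Q2 Q2x Q2\<xi> \<and>
        continuous_on kernel_domain (\<lambda>(x, \<xi>). G x \<xi>) \<and> continuous_on kernel_domain (\<lambda>(x, \<xi>). R x \<xi>) \<and>
        (\<forall>(x, \<xi>)\<in>kernel_domain.
           ((\<lambda>s. G s \<xi>) has_vector_derivative Gx x \<xi>) (at x within {0..\<xi>}) \<and>
           ((\<lambda>s. R s \<xi>) has_vector_derivative Rx x \<xi>) (at x within {0..\<xi>}) \<and>
           lam1 * K1x x \<xi> + lam1 * K1\<xi> x \<xi> = - \<sigma>21 * K2 x \<xi> - G x \<xi> \<bullet> \<Omega>1 \<and>
           lam1 * K2x x \<xi> - lam2 * K2\<xi> x \<xi> = - \<sigma>12 * K1 x \<xi> - G x \<xi> \<bullet> \<Omega>2 \<and>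
           lam1 *\<^sub>R Gx x \<xi> = - (K1 x \<xi> *\<^sub>R \<Theta>1) - K2 x \<xi> *\<^sub>R \<Theta>2 - G x \<xi> v* \<Psi> \<and>
           lam2 * Q1x x \<xi> - lam1 * Q1\<xi> x \<xi> = \<sigma>21 * Q2 x \<xi> + R x \<xi> \<bullet> \<Omega>1 \<and>
           lam2 * Q2x x \<xi> + lam2 * Q2\<xi> x \<xi> = \<sigma>12 * Q1 x \<xi> + R x \<xi> \<bullet> \<Omega>2 \<and>
           lam2 *\<^sub>R Rx x \<xi> = Q1 x \<xi> *\<^sub>R \<Theta>1 + Q2 x \<xi> *\<^sub>R \<Theta>2 + R x \<xi> v* \<Psi>)) \<and>
     (\<forall>x\<in>{0..1}.
        K1 x 1 = lam2 * \<rho> / lam1 * K2 x 1 \<and>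
        K2 x x = - \<sigma>12 / (lam1 + lam2) \<and>
        G x x = - (\<Theta>1 /\<^sub>R lam1) \<and>
        Q1 x x = \<sigma>21 / (lam1 + lam2) \<and>
        Q2 x 1 = lam1 / (lam2 * \<rho>) * Q1 x 1 \<and>
        R x x = \<Theta>2 /\<^sub>R lam2)"

definition volterra ::
    "(real \<Rightarrow> real \<Rightarrow> real) \<Rightarrow> (real \<Rightarrow> real \<Rightarrow> real) \<Rightarrow> (real \<Rightarrow> real \<Rightarrow> real^'n) \<Rightarrow>
     (real \<Rightarrow> real) \<Rightarrow> (real \<Rightarrow> real) \<Rightarrow> (real \<Rightarrow> real^'n) \<Rightarrow> real \<Rightarrow> real" where
  "volterra A B H a b v x =
     (LINT \<xi>:{x..1}|lebesgue. A x \<xi> * a \<xi>) + (LINT \<xi>:{x..1}|lebesgue. B x \<xi> * b \<xi>) +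
     (LINT \<xi>:{x..1}|lebesgue. H x \<xi> \<bullet> v \<xi>)"

definition bounded_kernel :: "(real \<Rightarrow> real \<Rightarrow> 'b::euclidean_space) \<Rightarrow> bool" where
  "bounded_kernel H \<longleftrightarrow> set_borel_measurable lebesgue kernel_domain (\<lambda>(x, \<xi>). H x \<xi>) \<and>
     bounded ((\<lambda>(x, \<xi>). H x \<xi>) ` kernel_domain)"

text \<open>The transformation \<open>(u, p, v) \<mapsto> (\<alpha>, \<beta>, v)\<close> with kernels \<open>K1, K2, G, Q1, Q2, R\<close> and the
  transformation \<open>(\<alpha>, \<beta>, v) \<mapsto> (u, p, v)\<close> with kernels \<open>L1, L2, S, M1, M2, E\<close> are two-sided
  inverses of each other on $L^2$.\<close>

definition inverse_kernels ::
    "(real \<Rightarrow> real \<Rightarrow> real) \<Rightarrow> (real \<Rightarrow> real \<Rightarrow> real) \<Rightarrow> (real \<Rightarrow> real \<Rightarrow> real^'n) \<Rightarrow>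
     (real \<Rightarrow> real \<Rightarrow> real) \<Rightarrow> (real \<Rightarrow> real \<Rightarrow> real) \<Rightarrow> (real \<Rightarrow> real \<Rightarrow> real^'n) \<Rightarrow>
     (real \<Rightarrow> real \<Rightarrow> real) \<Rightarrow> (real \<Rightarrow> real \<Rightarrow> real) \<Rightarrow> (real \<Rightarrow> real \<Rightarrow> real^'n) \<Rightarrow>
     (real \<Rightarrow> real \<Rightarrow> real) \<Rightarrow> (real \<Rightarrow> real \<Rightarrow> real) \<Rightarrow> (real \<Rightarrow> real \<Rightarrow> real^'n) \<Rightarrow> bool" where
  "inverse_kernels K1 K2 G Q1 Q2 R L1 L2 S M1 M2 E \<longleftrightarrow>
     bounded_kernel L1 \<and> bounded_kernel L2 \<and> bounded_kernel S \<and>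
     bounded_kernel M1 \<and> bounded_kernel M2 \<and> bounded_kernel E \<and>
     (\<forall>u p \<alpha> \<beta> v. in_L2 u \<and> in_L2 p \<and> in_L2 \<alpha> \<and> in_L2 \<beta> \<and> in_L2 v \<longrightarrow>
        ((AE x\<in>{0..1} in lebesgue. \<alpha> x = u x - volterra K1 K2 G u p v x \<and>
                                   \<beta> x = p x - volterra Q1 Q2 R u p v x) \<longleftrightarrow>
        (AE x\<in>{0..1} in lebesgue. u x = \<alpha> x + volterra L1 L2 S \<alpha> \<beta> v x \<and>
                                   p x = \<beta> x + volterra M1 M2 E \<alpha> \<beta> v x)))"


subsection \<open>The target system\<close>

definition v_rhs ::
    "real^'n \<Rightarrow> real^'n \<Rightarrow> real^'n^'n \<Rightarrow> (real \<Rightarrow> real \<Rightarrow> real^'n) \<Rightarrow> (real \<Rightarrow> real \<Rightarrow> real^'n) \<Rightarrow>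
     (real \<Rightarrow> real \<Rightarrow> real^'n^'n) \<Rightarrow> (real \<Rightarrow> real) \<Rightarrow> (real \<Rightarrow> real) \<Rightarrow> (real \<Rightarrow> real^'n) \<Rightarrow>
     real \<Rightarrow> real^'n" where
  "v_rhs \<Omega>1 \<Omega>2 \<Psi> N1 N2 N3 a b w x =
     a x *\<^sub>R \<Omega>1 + b x *\<^sub>R \<Omega>2 + \<Psi> *v w x +
     (LINT \<xi>:{x..1}|lebesgue. a \<xi> *\<^sub>R N1 x \<xi>) +
     (LINT \<xi>:{x..1}|lebesgue. b \<xi> *\<^sub>R N2 x \<xi>) +
     (LINT \<xi>:{x..1}|lebesgue. N3 x \<xi> *v w \<xi>)"

text \<open>For $L^2$ initial data, solutions of the initial-boundary value problem
  \[ \partial_t\alpha = -\lambda_1\partial_x\alpha,\quad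
     \partial_t\beta = \lambda_2\partial_x\beta,\quad
     \partial_t v = F(\alpha,\beta,v),\quad
     \beta(t,1)=\rho\,\alpha(t,1),\quad \alpha(t,0)=0 \]
  are understood in the usual weak sense for linear hyperbolic systems: \<open>\<alpha>, \<beta>, v\<close> are continuous
  in time with values in $L^2$, and the identity obtained by multiplying the equations with
  $C^1$ test functions \<open>f, g, h\<close> and integrating by parts over $[0,T]\times[0,1]$ holds. In this
  integration the boundary terms are
  \[ -\lambda_1\bigl(\alpha f\bigr)(t,1) + \lambda_1\bigl(\alpha f\bigr)(t,0)
     + \lambda_2\bigl(\beta g\bigr)(t,1) - \lambda_2\bigl(\beta g\bigr)(t,0), \]
  which under the two boundary conditions vanish for arbitrary outgoing traces
  $\alpha(t,1)$, $\beta(t,0)$ exactly when the test functions satisfy the adjoint conditions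
  $\lambda_1 f(t,1) = \lambda_2\rho\, g(t,1)$ and $g(t,0)=0$. The boundary conditions of the
  system are thus encoded by the class of test functions. The initial data are
  \<open>\<alpha> 0, \<beta> 0, v 0\<close>.\<close>

definition target_solution ::
    "real \<Rightarrow> real \<Rightarrow> real \<Rightarrow> real^'n \<Rightarrow> real^'n \<Rightarrow> real^'n^'n \<Rightarrow> (real \<Rightarrow> real \<Rightarrow> real^'n) \<Rightarrow>
     (real \<Rightarrow> real \<Rightarrow> real^'n) \<Rightarrow> (real \<Rightarrow> real \<Rightarrow> real^'n^'n) \<Rightarrow>
     (real \<Rightarrow> real \<Rightarrow> real) \<Rightarrow> (real \<Rightarrow> real \<Rightarrow> real) \<Rightarrow> (real \<Rightarrow> real \<Rightarrow> real^'n) \<Rightarrow> bool" where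
  "target_solution lam1 lam2 \<rho> \<Omega>1 \<Omega>2 \<Psi> N1 N2 N3 \<alpha> \<beta> v \<longleftrightarrow>
     L2_path \<alpha> \<and> L2_path \<beta> \<and> L2_path v \<and>
     (\<forall>T>0. \<forall>f ft fx g gt gx h ht hx.
        C1_with_partials ({0..T} \<times> {0..1}) f ft fx \<and>
        C1_with_partials ({0..T} \<times> {0..1}) g gt gx \<and>
        C1_with_partials ({0..T} \<times> {0..1}) h ht hx \<and>
        (\<forall>t\<in>{0..T}. lam1 * f t 1 = lam2 * \<rho> * g t 1 \<and> g t 0 = 0) \<longrightarrow>
        (LINT x:{0..1}|lebesgue. \<alpha> T x * f T x + \<beta> T x * g T x + v T x \<bullet> h T x) -
        (LINT x:{0..1}|lebesgue. \<alpha> 0 x * f 0 x + \<beta> 0 x * g 0 x + v 0 x \<bullet> h 0 x) =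
        (LINT t:{0..T}|lebesgue. (LINT x:{0..1}|lebesgue.
           \<alpha> t x * (ft t x + lam1 * fx t x) + \<beta> t x * (gt t x - lam2 * gx t x) +
           v t x \<bullet> ht t x + v_rhs \<Omega>1 \<Omega>2 \<Psi> N1 N2 N3 (\<alpha> t) (\<beta> t) (v t) x \<bullet> h t x)))"

definition exponentially_stable_L2 ::
    "((real \<Rightarrow> real \<Rightarrow> real) \<Rightarrow> (real \<Rightarrow> real \<Rightarrow> real) \<Rightarrow> (real \<Rightarrow> real \<Rightarrow> real^'n) \<Rightarrow> bool) \<Rightarrow> bool" where
  "exponentially_stable_L2 sol \<longleftrightarrow>
     (\<exists>C>0. \<exists>c>0. \<forall>\<alpha> \<beta> v. sol \<alpha> \<beta> v \<longrightarrow>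
        (\<forall>t\<ge>0. L2norm (\<alpha> t) + L2norm (\<beta> t) + L2norm (v t) \<le>
                C * exp (- c * t) * (L2norm (\<alpha> 0) + L2norm (\<beta> 0) + L2norm (v 0))))"

end

theory Submission
  imports Defs "HOL-Computational_Algebra.Fundamental_Theorem_Algebra"
begin

text \<open>The target system is a cascade. The component \<open>\<alpha>\<close> enters with the value \<open>0\<close> at \<open>x = 0\<close> and travels
to the right, so it has left the interval after the time \<open>1 / lam1\<close>; from then on \<open>\<beta>\<close> is fed with
\<open>0\<close> at \<open>x = 1\<close> and leaves after a further \<open>1 / lam2\<close>. A quantity that stays bounded by the initial
data and dies in finite time decays at every exponential rate
(\<open>extinction_imp_exp_bound\<close>, \<open>alpha_decay\<close>, \<open>beta_decay\<close>).

The component \<open>v\<close> solves, at each \<open>x\<close>, a linear ODE with the Hurwitz matrix \<open>\<Psi>\<close>, perturbed by the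
decaying terms in \<open>\<alpha>\<close> and \<open>\<beta>\<close> and by the Volterra term \<open>\<integral>\<^sub>x\<^sup>1 N3 x \<xi> *v v \<xi> d\<xi>\<close>. The last
term need not be small, but it only looks to the right of \<open>x\<close>. In the weighted norm of
\<open>W t x = exp (k * x) *\<^sub>R v t x\<close> it therefore has norm at most \<open>B / sqrt (2 * k)\<close>, where \<open>B\<close> bounds the
kernels (\<open>weighted_tail_integral_le\<close>), and a large \<open>k\<close> makes it a small perturbation of \<open>\<Psi>\<close>. The
kernels are bounded because the inverse kernels are (\<open>inverse_kernels_bounded\<close>). The decay of \<open>W\<close> then
follows from the variation-of-constants formula (\<open>v_duhamel_bound\<close>, \<open>v_decay\<close>).

Solutions are weak, so every step is done on the side of the test functions: a test function that solves
the adjoint equation turns the weak identity into a formula for the pairing of the solution at time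
\<open>T\<close> with a prescribed profile. For \<open>\<alpha>\<close> and \<open>\<beta>\<close> these are travelling waves (\<open>alpha_tested\<close>,
\<open>beta_tested\<close>); for \<open>v\<close> they are built from the solutions of \<open>z' = z v* \<Psi>\<close> (\<open>v_tested\<close>). The profiles
are polynomials times a fixed bump that vanishes to second order at \<open>0\<close> and \<open>1\<close>. These are dense in
\<open>L\<^sup>2(0,1)\<close>, so a bound on all pairings is a bound on the norm (\<open>L2norm_le_by_testing\<close>).

The decay of \<open>z' = z v* \<Psi>\<close> is obtained without a matrix exponential: a vector annihilated by a product
of factors \<open>A - a\<close> is handled by solving one equation \<open>z' = a z + y\<close> per factor (\<open>decays_step\<close>,
\<open>decays_if_spectrum_negative\<close>).\<close>

section \<open>Exponential decay for Hurwitz matrices\<close>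

text \<open>The initial value \<open>w\<close> is the start of an exponentially decaying solution of \<open>z' = A z\<close>. Constants may
depend on \<open>w\<close>; they become uniform by superposing finitely many solutions.\<close>

definition decays :: "('a::real_normed_vector \<Rightarrow> 'a) \<Rightarrow> 'a \<Rightarrow> bool" where
  "decays A w \<longleftrightarrow> (\<exists>z C c. c > 0 \<and> z 0 = w \<and>
     (\<forall>t\<ge>0. (z has_vector_derivative A (z t)) (at t within {0..}) \<and>
            norm (z t) \<le> C * exp (- c * t)))"

lemma norm_vector_smult_complex: "norm (c *s x) = cmod c * norm x" for x :: "complex^'n"
  unfolding norm_vec_def vector_smult_component norm_mult
  by (simp add: L2_set_right_distrib)

lemma bounded_bilinear_vector_smult:
  "bounded_bilinear (\<lambda>(c::complex) (x::complex^'n). c *s x)"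
proof
  show "\<exists>K. \<forall>(a::complex) (b::complex^'n). norm (a *s b) \<le> norm a * norm b * K"
    by (rule exI[of _ 1]) (simp add: norm_vector_smult_complex)
qed (vector algebra_simps scaleR_conv_of_real)+

lemmas has_vector_derivative_vector_smult =
  bounded_bilinear.has_vector_derivative[OF bounded_bilinear_vector_smult]
lemmas continuous_on_vector_smult =
  bounded_bilinear.continuous_on[OF bounded_bilinear_vector_smult]

lemma integral_has_vector_derivative_atLeast:
  fixes f :: "real \<Rightarrow> 'a::banach"
  assumes "continuous_on {0..} f" "t \<ge> 0"
  shows "((\<lambda>u. integral {0..u} f) has_vector_derivative f t) (at t within {0..})"
proof -
  have "((\<lambda>u. integral {0..u} f) has_vector_derivative f t) (at t within {0..t+1})"
    using assms by (intro integral_has_vector_derivative continuous_on_subset[OF assms(1)]) auto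
  moreover have "at t within {0..t+1} = at t within {0..}"
    by (rule at_within_nhd[of _ "{..<t+1}"]) auto
  ultimately show ?thesis by simp
qed

lemma has_vector_derivative_exp_linear:
  "((\<lambda>t. exp (a * complex_of_real t)) has_vector_derivative a * exp (a * complex_of_real t)) (at t within S)"
  by (rule has_vector_derivative_eq_rhs, rule field_vector_diff_chain_within[unfolded o_def,
        where g = "\<lambda>x. exp (a * x)" and g' = "a * exp (a * complex_of_real t)"])
     (auto intro!: derivative_eq_intros has_vector_derivative_of_real)

text \<open>Multiplying by the integrating factor \<open>exp (- a * t)\<close> makes the function constant.\<close>

lemma vector_ode_zero:
  fixes d :: "real \<Rightarrow> complex^'n"
  assumes d: "\<And>t. t \<ge> 0 \<Longrightarrow> (d has_vector_derivative a *s d t) (at t within {0..})"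
    and d0: "d 0 = 0" and t: "t \<ge> 0"
  shows "d t = 0"
proof -
  let ?e = "\<lambda>t. exp (- a * complex_of_real t) *s d t"
  have "(?e has_vector_derivative 0) (at s within {0..})" if "s \<in> {0..}" for s
  proof (rule has_vector_derivative_eq_rhs)
    show "(?e has_vector_derivative
        (exp (- a * complex_of_real s) *s (a *s d s) + (- a * exp (- a * complex_of_real s)) *s d s))
        (at s within {0..})"
      using that by (intro has_vector_derivative_vector_smult has_vector_derivative_exp_linear d) auto
  qed (vector algebra_simps)
  then obtain c where c: "\<And>s. s \<in> {0..} \<Longrightarrow> ?e s = c"
    using has_vector_derivative_zero_constant[of "{0..}" ?e] by (metis convex_real_interval(1))
  have "c = 0" using c[of 0] d0 by simp
  with c[of t] t have "cmod (exp (- a * complex_of_real t)) * norm (d t) = 0"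
    by (metis norm_vector_smult_complex atLeast_iff norm_zero)
  then show ?thesis by simp
qed

text \<open>Let \<open>y\<close> be the decaying solution that starts at \<open>(A - a) w\<close>. The inhomogeneous equation \<open>z' = a z + y\<close> with
\<open>z 0 = w\<close> has a decaying solution because \<open>Re a < 0\<close>. It also solves \<open>z' = A z\<close>: the defect
\<open>(A - a) z - y\<close> starts at \<open>0\<close> and satisfies \<open>d' = a d\<close>, so it vanishes.\<close>

lemma decays_step:
  fixes A :: "complex^'n^'n"
  assumes "Re a < 0" and "decays ((*v) A) (A *v w - a *s w)"
  shows "decays ((*v) A) w"
proof -
  obtain y C c where c: "c > 0" and y0: "y 0 = A *v w - a *s w"
    and yd: "\<And>t. t \<ge> 0 \<Longrightarrow> (y has_vector_derivative A *v y t) (at t within {0..})"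
    and yb: "\<And>t. t \<ge> 0 \<Longrightarrow> norm (y t) \<le> C * exp (- c * t)"
    using assms(2) unfolding decays_def by blast
  define r where "r = - Re a"
  \<comment> \<open>A rate below half of \<open>r\<close> keeps \<open>r - k\<close> away from \<open>0\<close>, so that
    integrating \<open>exp ((r - k) * s)\<close> is harmless even when \<open>c = r\<close>.\<close>
  define k where "k = min c (r / 2)"
  have k: "k > 0" "k \<le> c" "r - k \<ge> k" "r > 0" using c assms(1) by (auto simp: k_def r_def min_def)
  have C0: "C \<ge> 0" using yb[of 0] norm_ge_zero[of "y 0"] by (simp del: norm_ge_zero)
  have yc: "continuous_on {0..} y"
    using yd by (auto simp: continuous_on_eq_continuous_within intro: has_vector_derivative_continuous)
  define f where "f = (\<lambda>s. exp (- a * complex_of_real s) *s y s)"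
  have fc: "continuous_on {0..} f" unfolding f_def
    by (intro continuous_on_vector_smult yc continuous_intros)
  define z where "z = (\<lambda>t. exp (a * complex_of_real t) *s (w + integral {0..t} f))"
  have zd: "(z has_vector_derivative a *s z t + y t) (at t within {0..})" if "t \<ge> 0" for t
  proof (rule has_vector_derivative_eq_rhs)
    show "(z has_vector_derivative
       (exp (a * complex_of_real t) *s (0 + f t) + (a * exp (a * complex_of_real t)) *s (w + integral {0..t} f)))
       (at t within {0..})"
      unfolding z_def
      by (intro has_vector_derivative_vector_smult has_vector_derivative_exp_linear
          has_vector_derivative_add integral_has_vector_derivative_atLeast fc that
          has_vector_derivative_const)
    have "exp (a * complex_of_real t) * exp (- a * complex_of_real t) = 1"
      by (simp add: exp_minus)
    then show "exp (a * complex_of_real t) *s (0 + f t) + (a * exp (a * complex_of_real t)) *s (w + integral {0..t} f)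
      = a *s z t + y t"
      by (simp add: f_def z_def vector_smult_assoc)
  qed
  have z0: "z 0 = w" by (simp add: z_def)
  define d where "d = (\<lambda>t. A *v z t - a *s z t - y t)"
  have "d t = 0" if "t \<ge> 0" for t
  proof (rule vector_ode_zero[OF _ _ that])
    show "d 0 = 0" by (simp add: d_def z0 y0)
    show "(d has_vector_derivative a *s d t) (at t within {0..})" if "t \<ge> 0" for t
    proof (rule has_vector_derivative_eq_rhs)
      have "((\<lambda>t. a *s z t) has_vector_derivative (a *s (a *s z t + y t) + 0 *s z t)) (at t within {0..})"
        by (intro has_vector_derivative_vector_smult has_vector_derivative_const zd that)
      then show "(d has_vector_derivative
          (A *v (a *s z t + y t) - (a *s (a *s z t + y t) + 0 *s z t) - A *v y t)) (at t within {0..})"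
        unfolding d_def
        by (intro has_vector_derivative_diff yd that zd
           bounded_linear.has_vector_derivative[OF matrix_vector_mul_bounded_linear])
      show "A *v (a *s z t + y t) - (a *s (a *s z t + y t) + 0 *s z t) - A *v y t = a *s d t"
        by (simp add: d_def matrix_vector_right_distrib vector_scalar_commute[symmetric]
            vector_sub_rdistrib vector_add_ldistrib vector_ssub_ldistrib)
    qed
  qed
  then have zd': "(z has_vector_derivative A *v z t) (at t within {0..})" if "t \<ge> 0" for t
    using zd[OF that] that by (simp add: d_def algebra_simps)
  have fb: "norm (f s) \<le> C * exp ((r - k) * s)" if "s \<ge> 0" for s
  proof -
    have "norm (f s) = exp (r * s) * norm (y s)"
      by (simp add: f_def norm_vector_smult_complex r_def)
    also have "\<dots> \<le> exp (r * s) * (C * exp (- c * s))" using yb[OF that] by (intro mult_left_mono) auto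
    also have "\<dots> = C * exp ((r - c) * s)" by (simp add: exp_add[symmetric] algebra_simps)
    also have "\<dots> \<le> C * exp ((r - k) * s)"
      using C0 k that by (intro mult_left_mono) (auto intro!: mult_right_mono)
    finally show ?thesis .
  qed
  have Ib: "norm (integral {0..t} f) \<le> C / k * exp ((r - k) * t)" if "t \<ge> 0" for t
  proof -
    have "((\<lambda>s. C * exp ((r - k) * s)) has_integral
        (C / (r - k) * exp ((r - k) * t) - C / (r - k) * exp ((r - k) * 0))) {0..t}"
      using k that
      by (intro fundamental_theorem_of_calculus)
         (auto intro!: derivative_eq_intros simp: has_real_derivative_iff_has_vector_derivative[symmetric])
    then have I: "(\<lambda>s. C * exp ((r - k) * s)) integrable_on {0..t}"
      "integral {0..t} (\<lambda>s. C * exp ((r - k) * s)) = C / (r - k) * exp ((r - k) * t) - C / (r - k)"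
      by (auto simp: has_integral_iff)
    have "norm (integral {0..t} f) \<le> integral {0..t} (\<lambda>s. C * exp ((r - k) * s))"
    proof (rule integral_norm_bound_integral[OF _ I(1)])
      show "f integrable_on {0..t}"
        by (intro integrable_continuous_real continuous_on_subset[OF fc]) auto
    qed (use fb in auto)
    also have "\<dots> \<le> C / (r - k) * exp ((r - k) * t)" using I C0 k by simp
    also have "\<dots> \<le> C / k * exp ((r - k) * t)"
      using C0 k by (intro mult_right_mono divide_left_mono) auto
    finally show ?thesis .
  qed
  have zb: "norm (z t) \<le> (norm w + C / k) * exp (- k * t)" if "t \<ge> 0" for t
  proof -
    have "norm (z t) \<le> exp (- r * t) * (norm w + C / k * exp ((r - k) * t))"
      unfolding z_def norm_vector_smult_complex
      using norm_triangle_ineq[of w "integral {0..t} f"] Ib[OF that]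
      by (simp add: r_def)
    also have "\<dots> = exp (- r * t) * norm w + C / k * exp (- k * t)"
      by (simp add: algebra_simps exp_add[symmetric])
    also have "exp (- r * t) \<le> exp (- k * t)"
      using k that by (simp add: mult_right_mono)
    finally show ?thesis by (simp add: algebra_simps mult_right_mono)
  qed
  show ?thesis unfolding decays_def
    using k(1) z0 zd' zb by (intro exI[of _ z] exI[of _ "norm w + C / k"] exI[of _ k]) auto
qed

definition poly_mat_vec :: "complex poly \<Rightarrow> complex^'n^'n \<Rightarrow> complex^'n \<Rightarrow> complex^'n" where
  "poly_mat_vec p A w = (\<Sum>i\<le>degree p. coeff p i *s ((((*v) A) ^^ i) w))"

lemma poly_mat_vec_eq_sum:
  assumes "degree p \<le> n"
  shows "poly_mat_vec p A w = (\<Sum>i\<le>n. coeff p i *s ((((*v) A) ^^ i) w))"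
  unfolding poly_mat_vec_def
  by (rule sum.mono_neutral_left) (use assms in \<open>auto simp: coeff_eq_0\<close>)

text \<open>Splitting off a linear factor on the left serves to cancel a root that is not an eigenvalue; splitting it
off on the right, as in the next lemma, serves to pass from \<open>w\<close> to \<open>(A - a) w\<close>.\<close>

lemma poly_mat_vec_linear_factor:
  "poly_mat_vec ([:- a, 1:] * q) A w = A *v poly_mat_vec q A w - a *s poly_mat_vec q A w"
proof -
  define n where "n = degree q"
  define P where "P = (\<lambda>i. (((*v) A) ^^ i) w)"
  have "degree ([:- a, 1:] * q) \<le> Suc n"
    using degree_mult_le[of "[:- a, 1:]" q] by (simp add: n_def)
  then have "poly_mat_vec ([:- a, 1:] * q) A w = (\<Sum>i\<le>Suc n. coeff ([:- a, 1:] * q) i *s P i)"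
    unfolding P_def by (rule poly_mat_vec_eq_sum)
  also have "\<dots> = (\<Sum>i\<le>Suc n. coeff (pCons 0 q) i *s P i) - (\<Sum>i\<le>Suc n. (a * coeff q i) *s P i)"
    unfolding sum_subtractf[symmetric] vector_sub_rdistrib[symmetric]
    by (intro sum.cong) simp_all
  also have "(\<Sum>i\<le>Suc n. coeff (pCons 0 q) i *s P i) = (\<Sum>i\<le>n. coeff q i *s P (Suc i))"
    by (subst sum.atMost_Suc_shift) simp
  also have "\<dots> = A *v (\<Sum>i\<le>n. coeff q i *s P i)"
    by (simp add: vec.linear_sum[OF matrix_vector_mul_linear_gen] o_def P_def vector_scalar_commute)
  also have "(\<Sum>i\<le>Suc n. (a * coeff q i) *s P i) = a *s (\<Sum>i\<le>n. coeff q i *s P i)"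
    by (simp add: n_def coeff_eq_0 vec.scale_sum_right)
  finally show ?thesis by (simp add: poly_mat_vec_def P_def n_def)
qed

lemma poly_mat_vec_linear_factor_right:
  "poly_mat_vec ([:- a, 1:] * q) A w = poly_mat_vec q A (A *v w - a *s w)"
proof -
  have pow: "(((*v) A) ^^ i) (A *v w - a *s w)
      = A *v ((((*v) A) ^^ i) w) - a *s ((((*v) A) ^^ i) w)" for i
    by (induction i) (simp_all add: matrix_vector_mult_diff_distrib vector_scalar_commute)
  show ?thesis unfolding poly_mat_vec_linear_factor unfolding poly_mat_vec_def pow
    by (simp add: vec.linear_sum[OF matrix_vector_mul_linear_gen] o_def vector_scalar_commute[symmetric]
      vec.scale_sum_right sum_subtractf[symmetric] vector_ssub_ldistrib vector_smult_assoc mult.commute)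
qed

text \<open>The vectors \<open>w, A w, A\<^sup>2 w, \<dots>\<close> are linearly dependent over the reals, as the space has finite real
dimension.\<close>

lemma annihilating_poly_exists:
  fixes A :: "complex^'n^'n"
  shows "\<exists>p. p \<noteq> 0 \<and> poly_mat_vec p A w = 0"
proof -
  define N where "N = DIM(complex^'n)"
  define f where "f = (\<lambda>i. (((*v) A) ^^ i) w)"
  show ?thesis
  proof (cases "inj_on f {..N}")
    \<comment> \<open>Two equal powers give a relation directly; dependence of the set of
      powers would not see the repetition.\<close>
    case False
    then obtain i j where "i \<noteq> j" "f i = f j" by (auto simp: inj_on_def)
    then obtain i j where ij: "i < j" "f i = f j" by (metis nat_neq_iff)
    let ?p = "monom 1 j - monom 1 i :: complex poly"
    have "?p \<noteq> 0" using ij by (auto simp: monom_eq_iff')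
    have "degree ?p \<le> j"
      by (intro degree_diff_le) (use ij in \<open>auto simp: degree_monom_eq\<close>)
    then have "poly_mat_vec ?p A w = (\<Sum>k\<le>j. coeff ?p k *s f k)"
      unfolding f_def by (rule poly_mat_vec_eq_sum)
    also have "\<dots> = (\<Sum>k\<le>j. if k = j then f j else 0) - (\<Sum>k\<le>j. if k = i then f i else 0)"
      unfolding sum_subtractf[symmetric] using ij(1) by (intro sum.cong) auto
    also have "\<dots> = 0" using ij by simp
    finally show ?thesis using \<open>?p \<noteq> 0\<close> by blast
  next
    case True
    have "\<not> independent (f ` {..N})"
      using independent_bound[of "f ` {..N}"] card_image[OF True] by (auto simp: N_def)
    then obtain u v where uv: "v \<in> f ` {..N}" "u v \<noteq> 0" "(\<Sum>v\<in>f ` {..N}. u v *\<^sub>R v) = 0"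
      using real_vector.dependent_finite[of "f ` {..N}"] by auto
    define p where "p = (\<Sum>i\<le>N. monom (complex_of_real (u (f i))) i)"
    have cp: "coeff p k = (if k \<le> N then complex_of_real (u (f k)) else 0)" for k
      by (simp add: p_def coeff_sum)
    have "p \<noteq> 0" using uv(1,2) cp by (metis (no_types, lifting) atMost_iff coeff_0 imageE of_real_eq_0_iff)
    have "degree p \<le> N" by (rule degree_le) (simp add: cp)
    then have "poly_mat_vec p A w = (\<Sum>k\<le>N. coeff p k *s f k)"
      unfolding f_def by (rule poly_mat_vec_eq_sum)
    also have "\<dots> = (\<Sum>k\<le>N. u (f k) *\<^sub>R f k)"
      by (intro sum.cong) (auto simp: cp vec_eq_iff scaleR_conv_of_real[where 'a = complex])
    also have "\<dots> = 0" using uv(3) sum.reindex[OF True, of "\<lambda>v. u v *\<^sub>R v"] by simp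
    finally show ?thesis using \<open>p \<noteq> 0\<close> by blast
  qed
qed

text \<open>Induction on the degree of a polynomial that annihilates \<open>w\<close>. Take a root \<open>a\<close>. If \<open>Re a < 0\<close>, the
quotient polynomial annihilates \<open>(A - a) w\<close>, and \<open>decays_step\<close> leads back to \<open>w\<close>. Otherwise \<open>a\<close> is not an
eigenvalue, \<open>A - a\<close> is injective, and the quotient annihilates \<open>w\<close> itself.\<close>

lemma decays_if_spectrum_negative:
  fixes A :: "complex^'n^'n"
  assumes neg: "\<And>a w. w \<noteq> 0 \<Longrightarrow> A *v w = a *s w \<Longrightarrow> Re a < 0"
  shows "decays ((*v) A) w"
proof -
  have "decays ((*v) A) w" if "p \<noteq> 0" "poly_mat_vec p A w = 0" for p w
    using that
  proof (induction "degree p" arbitrary: p w rule: less_induct)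
    case less
    show ?case
    proof (cases "degree p = 0")
      case True
      then obtain c where "p = [:c:]" by (meson degree_eq_zeroE)
      with less.prems have "c *s w = 0" "c \<noteq> 0" by (auto simp: poly_mat_vec_def)
      then have "w = 0" by simp
      then show ?thesis unfolding decays_def
        by (intro exI[of _ "\<lambda>_. 0"] exI[of _ 0] exI[of _ 1]) simp
    next
      case False
      then obtain a where "poly p a = 0"
        using fundamental_theorem_of_algebra[of p] by (auto simp: constant_degree)
      then obtain q where pq: "p = [:- a, 1:] * q" by (auto simp: poly_eq_0_iff_dvd elim: dvdE)
      with less.prems(1) have q0: "q \<noteq> 0" by auto
      have deg: "degree q < degree p" unfolding pq using q0 by (subst degree_mult_eq) auto
      show ?thesis
      proof (cases "Re a < 0")
        case True
        have "poly_mat_vec q A (A *v w - a *s w) = 0"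
          using less.prems(2) unfolding pq poly_mat_vec_linear_factor_right .
        then have "decays ((*v) A) (A *v w - a *s w)" by (rule less.hyps[OF deg q0])
        then show ?thesis by (rule decays_step[OF True])
      next
        case False
        have "A *v poly_mat_vec q A w = a *s poly_mat_vec q A w"
          using less.prems(2) unfolding pq poly_mat_vec_linear_factor by simp
        then have "poly_mat_vec q A w = 0" using neg False by blast
        then show ?thesis by (rule less.hyps[OF deg q0])
      qed
    qed
  qed
  then show ?thesis using annihilating_poly_exists by blast
qed

lemma eigenvalue_transpose:
  fixes A :: "'a::field^'n^'n"
  assumes "w \<noteq> 0" "transpose A *v w = a *s w"
  obtains u where "u \<noteq> 0" "A *v u = a *s u"
proof -
  have e: "(B - mat a) *v u = B *v u - a *s u" for B :: "'a^'n^'n" and u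
    by (simp add: mat_def matrix_vector_mult_def vec_eq_iff left_diff_distrib sum_subtractf
       if_distrib[of "\<lambda>x. x * _"] cong: if_cong)
  have t: "transpose (A - mat a) = transpose A - mat a"
    by (auto simp: transpose_def vec_eq_iff mat_def)
  have "\<not> invertible (A - mat a)"
  proof
    assume "invertible (A - mat a)"
    then have "\<exists>B. B ** (transpose A - mat a) = mat 1"
      by (simp add: t[symmetric] left_invertible_transpose invertible_right_inverse)
    then show False using assms e[of "transpose A" w] by (auto simp: matrix_left_invertible_ker)
  qed
  then obtain u where "u \<noteq> 0" "(A - mat a) *v u = 0"
    by (auto simp: invertible_left_inverse matrix_left_invertible_ker)
  then show ?thesis using that e[of A u] by auto
qed

text \<open>The real part of a complex solution of a real system is a solution.\<close>

lemma decays_transpose_hurwitz: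
  fixes A :: "real^'n^'n" and w :: "real^'n"
  assumes "hurwitz A"
  shows "decays ((*v) (transpose A)) w"
proof -
  let ?A = "map_matrix complex_of_real (transpose A)"
  have At: "?A = transpose (map_matrix complex_of_real A)"
    by (simp add: transpose_def map_matrix_def vec_eq_iff)
  have "Re a < 0" if "u \<noteq> 0" "?A *v u = a *s u" for a u
    using that assms eigenvalue_transpose unfolding At hurwitz_def by metis
  then have "decays ((*v) ?A) ((\<chi> i. complex_of_real (w $ i)))"
    by (rule decays_if_spectrum_negative)
  then obtain z C c where c: "c > 0" and z0: "z 0 = (\<chi> i. complex_of_real (w $ i))"
    and zd: "\<And>t. t \<ge> 0 \<Longrightarrow> (z has_vector_derivative ?A *v z t) (at t within {0..})"
    and zb: "\<And>t. t \<ge> 0 \<Longrightarrow> norm (z t) \<le> C * exp (- c * t)"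
    unfolding decays_def by blast
  let ?R = "\<lambda>x::complex^'n. (\<chi> i. Re (x $ i)) :: real^'n"
  have Rn: "norm (?R x) \<le> norm x" for x
    unfolding norm_vec_def by (intro L2_set_mono) (auto simp: abs_Re_le_cmod)
  have "bounded_linear ?R"
    by (rule bounded_linear_intro[where K = 1]) (auto simp: vec_eq_iff Rn)
  note Rd = bounded_linear.has_vector_derivative[OF this zd]
  have RA: "?R (?A *v u) = transpose A *v ?R u" for u
    by (simp add: map_matrix_def matrix_vector_mult_def vec_eq_iff transpose_def)
  show ?thesis unfolding decays_def
  proof (rule exI[of _ "\<lambda>t. ?R (z t)"], rule exI[of _ C], rule exI[of _ c], intro conjI allI impI)
    show "?R (z 0) = w" by (simp add: z0 vec_eq_iff)
    show "((\<lambda>t. ?R (z t)) has_vector_derivative transpose A *v ?R (z t)) (at t within {0..})" if "t \<ge> 0" for t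
      using Rd[OF that] by (simp only: RA)
    show "norm (?R (z t)) \<le> C * exp (- c * t)" if "t \<ge> 0" for t
      using Rn[of "z t"] zb[OF that] by linarith
  qed fact
qed

text \<open>The solutions \<open>z i\<close> are the rows of the matrix exponential of \<open>A\<close>: the combination \<open>\<Sum>i. w $ i *\<^sub>R z i t\<close> is
the row vector \<open>w\<close> times \<open>exp (t A)\<close>.\<close>

lemma hurwitz_transpose_semigroup:
  fixes A :: "real^'n^'n"
  assumes "hurwitz A"
  obtains z :: "'n \<Rightarrow> real \<Rightarrow> real^'n" and M c where "c > 0" "M > 0"
    "\<And>i. z i 0 = axis i 1"
    "\<And>i t. t \<ge> 0 \<Longrightarrow> (z i has_vector_derivative z i t v* A) (at t within {0..})"
    "\<And>t w. t \<ge> 0 \<Longrightarrow> norm (\<Sum>i\<in>UNIV. w $ i *\<^sub>R z i t) \<le> M * exp (- c * t) * norm w"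
proof -
  have "\<forall>i::'n. \<exists>z C c. c > 0 \<and> z 0 = axis i 1 \<and>
     (\<forall>t\<ge>0. (z has_vector_derivative z t v* A) (at t within {0..}) \<and> norm (z t) \<le> C * exp (- c * t))"
    using decays_transpose_hurwitz[OF assms] unfolding decays_def by simp
  then obtain z C c where zc: "\<And>i::'n. c i > 0" and z0: "\<And>i. z i 0 = axis i 1"
    and zd: "\<And>i t. t \<ge> 0 \<Longrightarrow> (z i has_vector_derivative z i t v* A) (at t within {0..})"
    and zb: "\<And>i t. t \<ge> 0 \<Longrightarrow> norm (z i t) \<le> C i * exp (- c i * t)"
    by (metis (no_types, lifting))
  define k where "k = Min (range c)"
  have k: "k > 0" "\<And>i. k \<le> c i" using zc by (auto simp: k_def)
  define M where "M = 1 + (\<Sum>i\<in>UNIV. \<bar>C i\<bar>)"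
  show thesis
  proof (rule that[OF k(1) _ z0 zd])
    show "M > 0" unfolding M_def by (simp add: add_pos_nonneg sum_nonneg)
    fix t :: real and w :: "real^'n" assume t: "t \<ge> 0"
    have zb': "norm (z i t) \<le> \<bar>C i\<bar> * exp (- k * t)" for i
    proof -
      have "norm (z i t) \<le> \<bar>C i\<bar> * exp (- c i * t)"
        by (rule order_trans[OF zb[OF t]]) (auto intro: mult_right_mono)
      also have "\<dots> \<le> \<bar>C i\<bar> * exp (- k * t)" using k t by (intro mult_left_mono) (auto intro: mult_right_mono)
      finally show ?thesis .
    qed
    have "norm (\<Sum>i\<in>UNIV. w $ i *\<^sub>R z i t) \<le> (\<Sum>i\<in>UNIV. norm w * (\<bar>C i\<bar> * exp (- k * t)))"
      by (rule sum_norm_le) (auto intro!: mult_mono zb'[simplified] component_le_norm_cart)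
    also have "\<dots> = (M - 1) * exp (- k * t) * norm w"
      by (simp add: M_def sum_distrib_left sum_distrib_right algebra_simps)
    also have "\<dots> \<le> M * exp (- k * t) * norm w" by (intro mult_right_mono) auto
    finally show "norm (\<Sum>i\<in>UNIV. w $ i *\<^sub>R z i t) \<le> M * exp (- k * t) * norm w" .
  qed auto
qed

section \<open>The space $L^2(0,1)$\<close>

text \<open>Integrals over \<open>{0..1}\<close> are written over this measure of total mass \<open>1\<close>, so that the theory of
integrals over a whole measure space applies.\<close>

abbreviation unit_measure :: "real measure" where
  "unit_measure \<equiv> lebesgue_on {0..1}"

lemma unit_measure_space: "emeasure unit_measure (space unit_measure) = 1"
  by (simp add: emeasure_restrict_space)

interpretation unit_measure: finite_measure unit_measure
  by (rule finite_measureI) (simp only: unit_measure_space, simp)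

lemma set_lebesgue_integral_unit: "(LINT x:{0..1}|lebesgue. f x) = (\<integral>x. f x \<partial>unit_measure)"
  for f :: "real \<Rightarrow> 'a::{banach, second_countable_topology}"
  by (simp add: set_lebesgue_integral_def integral_restrict_space)

lemma set_integrable_unit: "set_integrable lebesgue {0..1} f \<longleftrightarrow> integrable unit_measure f"
  for f :: "real \<Rightarrow> 'a::{banach, second_countable_topology}"
  by (simp add: set_integrable_def integrable_restrict_space)

lemma in_L2_iff:
  "in_L2 f \<longleftrightarrow> f \<in> borel_measurable unit_measure \<and> integrable unit_measure (\<lambda>x. (norm (f x))\<^sup>2)"
  unfolding in_L2_def set_integrable_unit set_borel_measurable_def
  by (simp add: borel_measurable_restrict_space_iff)

lemma L2norm_eq: "L2norm f = sqrt (\<integral>x. (norm (f x))\<^sup>2 \<partial>unit_measure)"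
  by (simp add: L2norm_def set_lebesgue_integral_unit)

lemma L2norm_nonneg [simp]: "L2norm f \<ge> 0"
  by (simp add: L2norm_eq)

lemma L2norm_power2: "(L2norm f)\<^sup>2 = (\<integral>x. (norm (f x))\<^sup>2 \<partial>unit_measure)"
  by (simp add: L2norm_eq)

lemma AE_unit_measure:
  assumes "negligible N" and "\<And>x. 0 \<le> x \<Longrightarrow> x \<le> 1 \<Longrightarrow> x \<notin> N \<Longrightarrow> P x"
  shows "AE x in unit_measure. P x"
proof -
  have "AE x in lebesgue. x \<notin> N"
    using assms(1) by (intro AE_not_in) (simp add: negligible_iff_null_sets)
  then have "AE x in lebesgue. x \<in> {0..1} \<longrightarrow> P x"
    by eventually_elim (use assms(2) in auto)
  then show ?thesis by (simp add: AE_restrict_space_iff)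
qed

lemma in_L2_mono:
  assumes "in_L2 g" "f \<in> borel_measurable unit_measure"
    and "\<And>x. 0 \<le> x \<Longrightarrow> x \<le> 1 \<Longrightarrow> norm (f x) \<le> norm (g x)"
  shows "in_L2 f"
proof -
  note assms(2)[measurable]
  have "integrable unit_measure (\<lambda>x. (norm (f x))\<^sup>2)"
    using assms(1) unfolding in_L2_iff
    by (intro Bochner_Integration.integrable_bound[where g="\<lambda>x. (norm (f x))\<^sup>2"
          and f = "\<lambda>x. (norm (g x))\<^sup>2"])
       (auto intro!: AE_I2 power_mono assms(3) simp: space_restrict_space)
  then show ?thesis using assms(2) by (simp add: in_L2_iff)
qed

lemma L2norm_mono:
  assumes "in_L2 g" "in_L2 f"
    and "\<And>x. 0 \<le> x \<Longrightarrow> x \<le> 1 \<Longrightarrow> norm (f x) \<le> norm (g x)"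
  shows "L2norm f \<le> L2norm g"
  unfolding L2norm_eq using assms
  by (intro real_sqrt_le_mono integral_mono) (auto simp: in_L2_iff space_restrict_space intro: power_mono)

lemma in_L2_bounded:
  assumes "f \<in> borel_measurable unit_measure" "\<And>x. 0 \<le> x \<Longrightarrow> x \<le> 1 \<Longrightarrow> norm (f x) \<le> B"
  shows "in_L2 f"
proof (rule in_L2_mono[OF _ assms(1)])
  show "in_L2 (\<lambda>x::real. B)" by (simp add: in_L2_iff)
qed (use assms(2) in force)

lemma continuous_borel_measurable_unit:
  "continuous_on {0..1} f \<Longrightarrow> f \<in> borel_measurable unit_measure"
  by (rule continuous_imp_measurable_on_sets_lebesgue) auto

lemma in_L2_continuous:
  assumes "continuous_on {0..1} f" shows "in_L2 f"
proof -
  have "bounded (f ` {0..1})" by (intro compact_imp_bounded compact_continuous_image assms) auto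
  then obtain B where "\<forall>x\<in>{0..1}. norm (f x) \<le> B" by (auto simp: bounded_iff)
  then show ?thesis using continuous_borel_measurable_unit[OF assms] by (intro in_L2_bounded) auto
qed

lemma in_L2_scaleR_continuous:
  assumes "continuous_on {0..1} w" "in_L2 f"
  shows "in_L2 (\<lambda>x. w x *\<^sub>R f x)"
proof -
  have "bounded (w ` {0..1})" by (intro compact_imp_bounded compact_continuous_image assms) auto
  then obtain B where B: "\<forall>x\<in>{0..1}. norm (w x) \<le> B" by (auto simp: bounded_iff)
  note [measurable] = continuous_borel_measurable_unit[OF assms(1)]
  have [measurable]: "f \<in> borel_measurable unit_measure" using assms(2) by (simp add: in_L2_iff)
  show ?thesis
  proof (rule in_L2_mono)
    show "in_L2 (\<lambda>x. B *\<^sub>R f x)" using assms(2) by (simp add: in_L2_iff power_mult_distrib)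
    show "norm (w x *\<^sub>R f x) \<le> norm (B *\<^sub>R f x)" if "0 \<le> x" "x \<le> 1" for x
      using B that by (force intro: mult_right_mono)
  qed measurable
qed

lemma in_L2_diff:
  assumes "in_L2 f" "in_L2 g"
  shows "in_L2 (\<lambda>x. f x - g x)"
proof -
  have [measurable]: "f \<in> borel_measurable unit_measure" "g \<in> borel_measurable unit_measure"
    using assms by (auto simp: in_L2_iff)
  have "integrable unit_measure (\<lambda>x. (norm (f x - g x))\<^sup>2)"
  proof (rule Bochner_Integration.integrable_bound)
    show "integrable unit_measure (\<lambda>x. 2 * (norm (f x))\<^sup>2 + 2 * (norm (g x))\<^sup>2)"
      using assms by (simp add: in_L2_iff)
    have "(norm (a - b))\<^sup>2 \<le> 2 * (norm a)\<^sup>2 + 2 * (norm b)\<^sup>2" for a b :: 'a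
    proof -
      have "(norm (a - b))\<^sup>2 \<le> (norm a + norm b)\<^sup>2" by (intro power_mono norm_triangle_ineq4) auto
      also have "\<dots> \<le> 2 * (norm a)\<^sup>2 + 2 * (norm b)\<^sup>2"
        using zero_le_power2[of "norm a - norm b"] by (simp add: power2_eq_square algebra_simps)
      finally show ?thesis .
    qed
    then show "AE x in unit_measure. norm ((norm (f x - g x))\<^sup>2) \<le> norm (2 * (norm (f x))\<^sup>2 + 2 * (norm (g x))\<^sup>2)"
      by (intro AE_I2) simp
  qed measurable
  then show ?thesis by (simp add: in_L2_iff)
qed

lemma integrable_L2_product:
  assumes "in_L2 f" "in_L2 g"
  shows "integrable unit_measure (\<lambda>x. norm (f x) * norm (g x))"
proof -
  have [measurable]: "f \<in> borel_measurable unit_measure" "g \<in> borel_measurable unit_measure"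
    using assms by (auto simp: in_L2_iff)
  show ?thesis
  proof (rule Bochner_Integration.integrable_bound)
    show "integrable unit_measure (\<lambda>x. (norm (f x))\<^sup>2 + (norm (g x))\<^sup>2)"
      using assms by (simp add: in_L2_iff)
    have "a * b \<le> a\<^sup>2 + b\<^sup>2" if "a \<ge> 0" "b \<ge> 0" for a b :: real
      using zero_le_power2[of "a - b"] mult_nonneg_nonneg[OF that] by (simp add: power2_eq_square algebra_simps)
    then show "AE x in unit_measure. norm (norm (f x) * norm (g x)) \<le> norm ((norm (f x))\<^sup>2 + (norm (g x))\<^sup>2)"
      by (intro AE_I2) simp
  qed measurable
qed

lemma L2_Cauchy_Schwarz:
  assumes "in_L2 f" "in_L2 g"
  shows "(\<integral>x. norm (f x) * norm (g x) \<partial>unit_measure) \<le> L2norm f * L2norm g"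
proof -
  have [measurable]: "f \<in> borel_measurable unit_measure" "g \<in> borel_measurable unit_measure"
    using assms by (auto simp: in_L2_iff)
  let ?I = "\<integral>x. norm (f x) * norm (g x) \<partial>unit_measure"
  have sq: "(\<integral>\<^sup>+x. (ennreal (norm (h x)))\<^sup>2 \<partial>unit_measure) = ennreal ((L2norm h)\<^sup>2)" if "in_L2 h" for h :: "real \<Rightarrow> 'c::euclidean_space"
    using that by (simp add: in_L2_iff L2norm_power2 ennreal_power nn_integral_eq_integral)
  have "(\<integral>\<^sup>+x. ennreal (norm (f x)) * ennreal (norm (g x)) \<partial>unit_measure)\<^sup>2
      \<le> ennreal ((L2norm f)\<^sup>2) * ennreal ((L2norm g)\<^sup>2)"
    unfolding sq[OF assms(1), symmetric] sq[OF assms(2), symmetric]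
    by (rule Cauchy_Schwarz_nn_integral) measurable
  also have "(\<integral>\<^sup>+x. ennreal (norm (f x)) * ennreal (norm (g x)) \<partial>unit_measure) = ennreal ?I"
    by (simp add: ennreal_mult[symmetric] nn_integral_eq_integral integrable_L2_product[OF assms])
  finally have "?I\<^sup>2 \<le> (L2norm f * L2norm g)\<^sup>2"
    by (simp add: ennreal_power ennreal_mult[symmetric] power_mult_distrib)
  then show ?thesis by (rule power2_le_imp_le) simp
qed

lemma integrable_norm_L2: "in_L2 f \<Longrightarrow> integrable unit_measure (\<lambda>x. norm (f x))"
  using integrable_L2_product[of f "\<lambda>_. 1 :: real"] by (simp add: in_L2_iff)

lemma L1_le_L2norm:
  assumes "in_L2 f" shows "(\<integral>x. norm (f x) \<partial>unit_measure) \<le> L2norm f"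
proof -
  have "L2norm (\<lambda>_. 1::real) = 1"
    using unit_measure_space by (simp add: L2norm_eq measure_def)
  then show ?thesis
    using L2_Cauchy_Schwarz[OF assms, of "\<lambda>_. 1 :: real"] by (simp add: in_L2_iff)
qed

lemma integrable_inner_L2:
  assumes "in_L2 f" "in_L2 g"
  shows "integrable unit_measure (\<lambda>x. f x \<bullet> g x)"
proof -
  have [measurable]: "f \<in> borel_measurable unit_measure" "g \<in> borel_measurable unit_measure"
    using assms by (auto simp: in_L2_iff)
  show ?thesis
    by (rule Bochner_Integration.integrable_bound[OF integrable_L2_product[OF assms]])
       (auto intro!: AE_I2 simp: Cauchy_Schwarz_ineq2)
qed

lemma inner_L2_le:
  assumes "in_L2 f" "in_L2 g"
  shows "\<bar>\<integral>x. f x \<bullet> g x \<partial>unit_measure\<bar> \<le> L2norm f * L2norm g"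
proof -
  have "\<bar>\<integral>x. f x \<bullet> g x \<partial>unit_measure\<bar> \<le> (\<integral>x. norm (f x) * norm (g x) \<partial>unit_measure)"
    by (rule order_trans[OF integral_abs_bound integral_mono])
       (auto simp: integrable_inner_L2 integrable_L2_product assms Cauchy_Schwarz_ineq2)
  also have "\<dots> \<le> L2norm f * L2norm g" by (rule L2_Cauchy_Schwarz[OF assms])
  finally show ?thesis .
qed

lemma L2norm_triangle:
  assumes "in_L2 f" "in_L2 g"
  shows "L2norm f \<le> L2norm (\<lambda>x. f x - g x) + L2norm g"
proof -
  note d = in_L2_diff[OF assms]
  have "(L2norm f)\<^sup>2 = (\<integral>x. f x \<bullet> f x \<partial>unit_measure)"
    by (simp add: L2norm_power2 power2_norm_eq_inner)
  also have "\<dots> = (\<integral>x. (f x - g x) \<bullet> f x + g x \<bullet> f x \<partial>unit_measure)"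
    by (simp add: inner_diff_left)
  also have "\<dots> = (\<integral>x. (f x - g x) \<bullet> f x \<partial>unit_measure) + (\<integral>x. g x \<bullet> f x \<partial>unit_measure)"
    by (intro Bochner_Integration.integral_add integrable_inner_L2 d assms)
  also have "\<dots> \<le> L2norm (\<lambda>x. f x - g x) * L2norm f + L2norm g * L2norm f"
    using inner_L2_le[OF d assms(1)] inner_L2_le[OF assms(2,1)] by linarith
  finally have "L2norm f * L2norm f \<le> (L2norm (\<lambda>x. f x - g x) + L2norm g) * L2norm f"
    by (simp add: power2_eq_square algebra_simps)
  then show ?thesis
    using L2norm_nonneg[of f] L2norm_nonneg[of g] L2norm_nonneg[of "\<lambda>x. f x - g x"]
    by (cases "L2norm f = 0") (auto simp del: L2norm_nonneg)
qed

lemma L2norm_tendsto_0: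
  assumes G: "in_L2 G" and F: "\<And>k. F k \<in> borel_measurable unit_measure"
    and le: "\<And>k x. 0 \<le> x \<Longrightarrow> x \<le> 1 \<Longrightarrow> norm (F k x) \<le> norm (G x)"
    and lim: "AE x in unit_measure. (\<lambda>k. F k x) \<longlonglongrightarrow> 0"
  shows "(\<lambda>k. L2norm (F k)) \<longlonglongrightarrow> 0"
proof -
  note F[measurable]
  have "(\<lambda>k. \<integral>x. (norm (F k x))\<^sup>2 \<partial>unit_measure) \<longlonglongrightarrow> (\<integral>x. 0 \<partial>unit_measure)"
  proof (rule integral_dominated_convergence[where w = "\<lambda>x. (norm (G x))\<^sup>2"])
    show "integrable unit_measure (\<lambda>x. (norm (G x))\<^sup>2)" using G by (simp add: in_L2_iff)
    show "AE x in unit_measure. (\<lambda>k. (norm (F k x))\<^sup>2) \<longlonglongrightarrow> 0"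
      using lim by eventually_elim (auto intro!: tendsto_eq_intros)
  qed (auto intro!: AE_I2 power_mono le simp: space_restrict_space)
  from tendsto_real_sqrt[OF this] show ?thesis by (simp add: L2norm_eq)
qed

section \<open>Density of test profiles\<close>

text \<open>The maximum extends \<open>(x * (1 - x))\<^sup>2\<close> by \<open>0\<close> outside \<open>(0,1)\<close>. As the zeros at the end points are double,
the extension is \<open>C\<^sup>1\<close> on the whole line, and a product with a polynomial may be shifted like a wave.\<close>

definition bump :: "real \<Rightarrow> real" where
  "bump x = (max 0 (x * (1 - x)))\<^sup>2"

lemma bump_outside: "x \<le> 0 \<or> x \<ge> 1 \<Longrightarrow> bump x = 0"
proof -
  assume "x \<le> 0 \<or> x \<ge> 1"
  then have "x * (1 - x) \<le> 0" by (auto intro: mult_nonpos_nonneg mult_nonneg_nonpos)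
  then show ?thesis by (simp add: bump_def)
qed

lemma bump_pos: "0 < x \<Longrightarrow> x < 1 \<Longrightarrow> bump x > 0"
  by (auto simp: bump_def)

lemma bump_nonneg: "bump x \<ge> 0" by (simp add: bump_def)

lemma continuous_on_bump: "continuous_on S bump"
  unfolding bump_def by (intro continuous_intros)

lemma bump_le_1: assumes "0 \<le> x" "x \<le> 1" shows "bump x \<le> 1"
proof -
  have "x * (1 - x) \<le> 1" using assms by (simp add: mult_le_one)
  then show ?thesis unfolding bump_def by (intro power_le_one) auto
qed

lemma bump_has_derivative:
  "(bump has_real_derivative 2 * max 0 (x * (1 - x)) * (1 - 2 * x)) (at x)"
proof -
  have sq: "((\<lambda>y::real. (max 0 y)\<^sup>2) has_real_derivative 2 * max 0 y) (at y)" for y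
  proof -
    consider "y < 0" | "y > 0" | "y = 0" by linarith
    then show ?thesis
    proof cases
      case 1
      have "((\<lambda>y::real. 0) has_real_derivative 0) (at y)" by simp
      then have "((\<lambda>y::real. (max 0 y)\<^sup>2) has_real_derivative 0) (at y)"
        by (rule DERIV_cong_ev[THEN iffD1, rotated -1, OF _ refl _ refl])
           (use 1 in \<open>auto intro!: eventually_mono[OF eventually_nhds_in_open[of "{..<0}"]]\<close>)
      then show ?thesis using 1 by simp
    next
      case 2
      have "((\<lambda>y::real. y\<^sup>2) has_real_derivative 2 * y) (at y)" by (auto intro!: derivative_eq_intros)
      then have "((\<lambda>y::real. (max 0 y)\<^sup>2) has_real_derivative 2 * y) (at y)"
        by (rule DERIV_cong_ev[THEN iffD1, rotated -1, OF _ refl _ refl])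
           (use 2 in \<open>auto intro!: eventually_mono[OF eventually_nhds_in_open[of "{0<..}"]]\<close>)
      then show ?thesis using 2 by simp
    next
      case 3
      have "((\<lambda>h::real. (max 0 h)\<^sup>2 / h) \<longlongrightarrow> 0) (at 0)"
      proof (rule Lim_null_comparison)
        show "\<forall>\<^sub>F h::real in at 0. norm ((max 0 h)\<^sup>2 / h) \<le> \<bar>h\<bar>"
          by (intro always_eventually) (auto simp: max_def power2_eq_square)
      qed (auto intro!: tendsto_eq_intros)
      then show ?thesis using 3 by (simp add: DERIV_def)
    qed
  qed
  have "((\<lambda>x. x * (1 - x)) has_real_derivative (1 - 2 * x)) (at x)"
    by (auto intro!: derivative_eq_intros)
  from DERIV_chain2[OF sq this] show ?thesis by (simp add: bump_def[abs_def])
qed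

text \<open>Cut \<open>X\<close> off where it is large or \<open>bump\<close> is small; what remains is \<open>bump\<close> times a bounded measurable \<open>U\<close>.
Such a \<open>U\<close> is an almost everywhere limit of continuous functions, these may be retracted onto a ball and
then replaced by polynomials (Weierstrass), and dominated convergence applies.\<close>

lemma L2_dense_bump_polynomial:
  fixes X :: "real \<Rightarrow> 'b::euclidean_space"
  assumes X: "in_L2 X" and e: "e > 0"
  obtains p :: "real \<Rightarrow> 'b" where "polynomial_function p" "L2norm (\<lambda>x. X x - bump x *\<^sub>R p x) < e"
proof -
  have [measurable]: "X \<in> borel_measurable unit_measure" using X by (simp add: in_L2_iff)
  have [measurable]: "bump \<in> borel_measurable unit_measure"
    by (rule continuous_borel_measurable_unit[OF continuous_on_bump])
  define Y where "Y = (\<lambda>m::nat. \<lambda>x. if norm (X x) \<le> Suc m \<and> bump x * Suc m \<ge> 1 then X x else 0)"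
  have [measurable]: "Y m \<in> borel_measurable unit_measure" for m unfolding Y_def by measurable
  have "(\<lambda>m. L2norm (\<lambda>x. X x - Y m x)) \<longlonglongrightarrow> 0"
  proof (rule L2norm_tendsto_0[OF X])
    show "AE x in unit_measure. (\<lambda>m. X x - Y m x) \<longlonglongrightarrow> 0"
    proof (rule AE_unit_measure[of "{0,1}"])
      fix x :: real assume "0 \<le> x" "x \<le> 1" "x \<notin> {0,1}"
      then have b: "bump x > 0" by (intro bump_pos) auto
      obtain k :: nat where k: "norm (X x) < k" using reals_Archimedean2 by blast
      obtain l :: nat where l: "1 / bump x < l" using reals_Archimedean2 by blast
      have "\<forall>m\<ge>max k l. X x - Y m x = 0"
      proof (intro allI impI)
        fix m assume m: "m \<ge> max k l"
        have "1 < bump x * l" using l b by (simp add: field_simps)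
        also have "\<dots> \<le> bump x * Suc m" using m b by (intro mult_left_mono) auto
        finally show "X x - Y m x = 0" using k m by (auto simp: Y_def)
      qed
      then show "(\<lambda>m. X x - Y m x) \<longlonglongrightarrow> 0"
        by (intro tendsto_eventually) (rule eventually_sequentiallyI[of "max k l"], simp)
    qed simp
  qed (auto simp: Y_def)
  then obtain m where m: "L2norm (\<lambda>x. X x - Y m x) < e / 2"
    using e by (auto dest!: LIMSEQ_D[where r = "e/2"] simp: abs_of_nonneg)
  define B where "B = real (Suc m) * real (Suc m)"
  have B: "B > 0" by (simp add: B_def)
  define U where "U = (\<lambda>x. if x \<in> {0..1} then Y m x /\<^sub>R bump x else 0)"
  have UB: "norm (U x) \<le> B" for x
  proof (cases "norm (X x) \<le> Suc m \<and> bump x * Suc m \<ge> 1")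
    case True
    then have b: "bump x > 0" by (metis bump_nonneg less_eq_real_def mult_zero_left not_one_le_zero)
    have "norm (X x) \<le> real (Suc m) * 1" using True by simp
    also have "\<dots> \<le> real (Suc m) * (bump x * real (Suc m))" using True by (intro mult_left_mono) auto
    also have "\<dots> = B * bump x" by (simp only: B_def mult_ac)
    finally have "norm (X x) / bump x \<le> B" using b by (simp only: pos_divide_le_eq)
    moreover have "norm (Y m x /\<^sub>R bump x) = norm (X x) / bump x"
      using True b by (simp add: Y_def divide_inverse_commute)
    ultimately show ?thesis using B by (simp add: U_def)
  qed (use B in \<open>auto simp: U_def Y_def\<close>)
  have "(\<lambda>x. Y m x /\<^sub>R bump x) \<in> borel_measurable unit_measure" by measurable
  then have "(\<lambda>x. indicat_real {0..1} x *\<^sub>R (Y m x /\<^sub>R bump x)) \<in> borel_measurable lebesgue"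
    by (subst (asm) borel_measurable_restrict_space_iff) auto
  also have "(\<lambda>x. indicat_real {0..1} x *\<^sub>R (Y m x /\<^sub>R bump x)) = U"
    by (auto simp: U_def indicator_def)
  finally have "U \<in> borel_measurable lebesgue" .
  then have "U measurable_on UNIV" by (intro lebesgue_measurable_imp_measurable_on) auto
  then obtain N g where N: "negligible N" and gc: "\<And>n. continuous_on UNIV (g n)"
    and gl: "\<And>x. x \<notin> N \<Longrightarrow> (\<lambda>n. g n x) \<longlonglongrightarrow> U x"
    unfolding measurable_on_def by auto
  \<comment> \<open>The continuous approximants need not be
    bounded; \<open>c\<close> retracts onto the ball of radius \<open>B\<close> and fixes the values of \<open>U\<close>.\<close>
  define c where "c = (\<lambda>y::'b. (B / max B (norm y)) *\<^sub>R y)"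
  have cc: "continuous_on UNIV c" unfolding c_def using B by (intro continuous_intros) auto
  have cB: "norm (c y) \<le> B" for y unfolding c_def using B
    by (auto simp: max_def field_simps)
  have cU: "c (U x) = U x" for x unfolding c_def using UB[of x] B by (simp add: max_absorb1)
  have "\<exists>p. polynomial_function p \<and> (\<forall>x\<in>{0..1}. norm (c (g n x) - p x) < 1 / Suc n)" for n
  proof -
    have "continuous_on {0..1::real} (\<lambda>x. c (g n x))"
      by (rule continuous_on_compose2[OF cc continuous_on_subset[OF gc]]) auto
    then show ?thesis
      using Stone_Weierstrass_polynomial_function[of "{0..1::real}" "\<lambda>x. c (g n x)" "1 / Suc n"] by auto
  qed
  then obtain p where pp: "\<And>n. polynomial_function (p n)"
    and pa: "\<And>n x. 0 \<le> x \<Longrightarrow> x \<le> 1 \<Longrightarrow> norm (c (g n x) - p n x) < 1 / Suc n"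
    by (metis atLeastAtMost_iff)
  have pm: "p n \<in> borel_measurable unit_measure" for n
    by (intro continuous_borel_measurable_unit continuous_on_polymonial_function pp)
  note pm[measurable]
  have YU: "Y m x = bump x *\<^sub>R U x" if "0 \<le> x" "x \<le> 1" for x
    using that by (cases "bump x = 0") (auto simp: U_def Y_def)
  have "(\<lambda>n. L2norm (\<lambda>x. Y m x - bump x *\<^sub>R p n x)) \<longlonglongrightarrow> 0"
  proof (rule L2norm_tendsto_0[where G = "\<lambda>_. 2 * B + 1"])
    show "in_L2 (\<lambda>_. 2 * B + 1)" by (simp add: in_L2_iff)
    show "AE x in unit_measure. (\<lambda>n. Y m x - bump x *\<^sub>R p n x) \<longlonglongrightarrow> 0"
    proof (rule AE_unit_measure[OF N])
      fix x :: real assume x: "0 \<le> x" "x \<le> 1" "x \<notin> N"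
      have "(\<lambda>n. c (g n x)) \<longlonglongrightarrow> c (U x)"
        using gl[OF x(3)] cc by (intro continuous_on_tendsto_compose[OF cc]) auto
      moreover have "(\<lambda>n. c (g n x) - p n x) \<longlonglongrightarrow> 0"
        by (rule Lim_null_comparison[OF _ LIMSEQ_inverse_real_of_nat])
           (use pa[OF x(1,2)] in \<open>auto intro!: always_eventually less_imp_le simp: inverse_eq_divide\<close>)
      ultimately have "(\<lambda>n. c (g n x) - (c (g n x) - p n x)) \<longlonglongrightarrow> c (U x) - 0"
        by (rule tendsto_diff)
      then have "(\<lambda>n. Y m x - bump x *\<^sub>R p n x) \<longlonglongrightarrow> Y m x - bump x *\<^sub>R U x"
        by (intro tendsto_intros) (simp add: cU)
      then show "(\<lambda>n. Y m x - bump x *\<^sub>R p n x) \<longlonglongrightarrow> 0" using YU[OF x(1,2)] by simp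
    qed
    fix n and x :: real assume x: "0 \<le> x" "x \<le> 1"
    have "norm (p n x) \<le> norm (c (g n x)) + norm (c (g n x) - p n x)"
      by (metis add.commute norm_minus_commute norm_triangle_sub)
    also have "\<dots> \<le> B + 1"
      using pa[OF x, of n] cB[of "g n x"] by (smt (verit) divide_le_eq_1 of_nat_Suc of_nat_0_le_iff)
    finally have 1: "norm (p n x) \<le> B + 1" .
    have "norm (Y m x - bump x *\<^sub>R p n x) = bump x * norm (U x - p n x)"
      by (simp add: YU[OF x] scaleR_diff_right[symmetric] bump_nonneg)
    also have "\<dots> \<le> 1 * (2 * B + 1)"
      using norm_triangle_ineq4[of "U x" "p n x"] UB[of x] 1
      by (intro mult_mono bump_le_1 x) auto
    finally show "norm (Y m x - bump x *\<^sub>R p n x) \<le> norm (2 * B + 1)" by simp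
  qed measurable
  then obtain n where n: "L2norm (\<lambda>x. Y m x - bump x *\<^sub>R p n x) < e / 2"
    using e by (auto dest!: LIMSEQ_D[where r = "e/2"] simp: abs_of_nonneg)
  have Ym: "in_L2 (Y m)" by (rule in_L2_mono[OF X]) (auto simp: Y_def)
  have bp: "in_L2 (\<lambda>x. bump x *\<^sub>R p n x)"
    by (intro in_L2_continuous continuous_intros continuous_on_bump continuous_on_polymonial_function pp)
  have "L2norm (\<lambda>x. X x - bump x *\<^sub>R p n x)
      \<le> L2norm (\<lambda>x. (X x - bump x *\<^sub>R p n x) - (Y m x - bump x *\<^sub>R p n x)) + L2norm (\<lambda>x. Y m x - bump x *\<^sub>R p n x)"
    by (intro L2norm_triangle in_L2_diff X Ym bp)
  also have "\<dots> < e" using m n by simp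
  finally show ?thesis using that pp by blast
qed

text \<open>Approximating \<open>X\<close> itself by test profiles gives \<open>\<parallel>X\<parallel>\<^sup>2 \<le> M \<parallel>X\<parallel>\<close> in the limit.\<close>

lemma L2norm_le_by_testing:
  fixes X :: "real \<Rightarrow> 'b::euclidean_space"
  assumes X: "in_L2 X" and M: "M \<ge> 0"
    and test: "\<And>p. polynomial_function p \<Longrightarrow>
      \<bar>\<integral>x. X x \<bullet> (bump x *\<^sub>R p x) \<partial>unit_measure\<bar> \<le> M * L2norm (\<lambda>x. bump x *\<^sub>R p x)"
  shows "L2norm X \<le> M"
proof (rule ccontr)
  define n where "n = L2norm X"
  assume "\<not> L2norm X \<le> M"
  then have n: "n > M" by (simp add: n_def)
  \<comment> \<open>The accuracy is chosen such that \<open>n\<^sup>2 \<le> n e + M (e + n)\<close>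
    is contradictory.\<close>
  define e where "e = n * (n - M) / (2 * (n + M))"
  have e: "e > 0" using n M by (simp add: e_def)
  obtain p :: "real \<Rightarrow> 'b" where p: "polynomial_function p" "L2norm (\<lambda>x. X x - bump x *\<^sub>R p x) < e"
    using L2_dense_bump_polynomial[OF X e] .
  let ?p = "\<lambda>x. bump x *\<^sub>R p x"
  have bp: "in_L2 ?p"
    by (intro in_L2_continuous continuous_intros continuous_on_bump continuous_on_polymonial_function p)
  note d = in_L2_diff[OF X bp]
  have "n\<^sup>2 = (\<integral>x. X x \<bullet> X x \<partial>unit_measure)"
    by (simp add: n_def L2norm_power2 power2_norm_eq_inner)
  also have "\<dots> = (\<integral>x. X x \<bullet> (X x - ?p x) + X x \<bullet> ?p x \<partial>unit_measure)"
    by (simp add: inner_diff_right)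
  also have "\<dots> = (\<integral>x. X x \<bullet> (X x - ?p x) \<partial>unit_measure) + (\<integral>x. X x \<bullet> ?p x \<partial>unit_measure)"
    by (intro Bochner_Integration.integral_add integrable_inner_L2 d X bp)
  also have "\<dots> \<le> n * L2norm (\<lambda>x. X x - ?p x) + M * L2norm ?p"
    using inner_L2_le[OF X d] test[OF p(1)] by (simp add: n_def)
  also have "\<dots> \<le> n * e + M * (e + n)"
  proof (intro add_mono mult_left_mono)
    have "L2norm ?p \<le> L2norm (\<lambda>x. ?p x - X x) + L2norm X" by (rule L2norm_triangle[OF bp X])
    also have "L2norm (\<lambda>x. ?p x - X x) = L2norm (\<lambda>x. X x - ?p x)"
      by (simp add: L2norm_def norm_minus_commute)
    finally show "L2norm ?p \<le> e + n" using p(2) by (simp add: n_def)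
  qed (use n M p in auto)
  finally have "n * (n - M) \<le> e * (n + M)" by (simp add: power2_eq_square algebra_simps)
  also have "\<dots> = n * (n - M) / 2"
  proof -
    have "n + M \<noteq> 0" using n M by simp
    then have "n * (n - M) / (2 * (n + M)) * (n + M) = n * (n - M) / 2"
      by (simp add: divide_simps)
    then show ?thesis by (simp only: e_def)
  qed
  finally show False using n M mult_pos_pos[of n "n - M"] by auto
qed

section \<open>Continuously differentiable test functions\<close>

lemma C1_with_partials_0: "C1_with_partials D (\<lambda>t x. 0) (\<lambda>t x. 0) (\<lambda>t x. 0)"
  by (simp add: C1_with_partials_def case_prod_unfold)

lemma C1_with_partials_sum:
  assumes "finite I" "\<And>i. i \<in> I \<Longrightarrow> C1_with_partials D (f i) (f1 i) (f2 i)"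
  shows "C1_with_partials D (\<lambda>t x. \<Sum>i\<in>I. f i t x) (\<lambda>t x. \<Sum>i\<in>I. f1 i t x) (\<lambda>t x. \<Sum>i\<in>I. f2 i t x)"
  using assms unfolding C1_with_partials_def case_prod_unfold
  by (auto intro!: continuous_on_sum has_derivative_eq_rhs[OF has_derivative_sum]
      simp: scaleR_sum_right sum.distrib)

lemma C1_with_partials_plane_wave:
  fixes \<phi> :: "real \<Rightarrow> 'b::real_normed_vector"
  assumes d: "\<And>y. (\<phi> has_vector_derivative \<phi>' y) (at y)" and c: "continuous_on UNIV \<phi>'"
  shows "C1_with_partials D (\<lambda>t x. \<phi> (a + b * t + d * x))
    (\<lambda>t x. b *\<^sub>R \<phi>' (a + b * t + d * x)) (\<lambda>t x. d *\<^sub>R \<phi>' (a + b * t + d * x))"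
proof -
  have c': "continuous_on D (\<lambda>p. \<phi>' (a + b * fst p + d * snd p))"
    by (rule continuous_on_compose2[OF c]) (auto intro!: continuous_intros)
  have "((\<lambda>p. \<phi> (a + b * fst p + d * snd p)) has_derivative
      (\<lambda>q. fst q *\<^sub>R b *\<^sub>R \<phi>' (a + b * t + d * x) + snd q *\<^sub>R d *\<^sub>R \<phi>' (a + b * t + d * x))) (at (t, x) within D)"
    for t x
  proof (rule has_derivative_eq_rhs)
    have "((\<lambda>p. a + b * fst p + d * snd p) has_derivative (\<lambda>q. b * fst q + d * snd q)) (at (t, x) within D)"
      by (auto intro!: derivative_eq_intros)
    moreover have "(\<phi> has_derivative (\<lambda>h. h *\<^sub>R \<phi>' (a + b * t + d * x))) (at (a + b * t + d * x))"
      using d by (simp add: has_vector_derivative_def)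
    ultimately show "((\<lambda>p. \<phi> (a + b * fst p + d * snd p)) has_derivative
        (\<lambda>q. (b * fst q + d * snd q) *\<^sub>R \<phi>' (a + b * t + d * x))) (at (t, x) within D)"
      using has_derivative_compose[of "\<lambda>p. a + b * fst p + d * snd p" _ "(t, x)" D \<phi>] by simp
  qed (auto simp: algebra_simps)
  then show ?thesis
    unfolding C1_with_partials_def case_prod_unfold
    by (auto intro!: continuous_intros c')
qed

lemma C1_with_partials_product:
  fixes z :: "real \<Rightarrow> 'b::real_normed_vector"
  assumes a: "\<And>x. (a has_real_derivative a' x) (at x)" and ac: "continuous_on UNIV a'"
    and z: "\<And>t. t \<in> S \<Longrightarrow> (z has_vector_derivative z' t) (at t within S)"
    and zc: "continuous_on S z'"
  shows "C1_with_partials (S \<times> X) (\<lambda>t x. a x *\<^sub>R z t) (\<lambda>t x. a x *\<^sub>R z' t) (\<lambda>t x. a' x *\<^sub>R z t)"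
proof -
  have "continuous_on UNIV a" by (rule DERIV_continuous_on) (rule a)
  then have a1: "continuous_on (S \<times> X) (\<lambda>p. a (snd p))"
    by (rule continuous_on_compose2) (auto intro!: continuous_intros)
  have a2: "continuous_on (S \<times> X) (\<lambda>p. a' (snd p))"
    by (rule continuous_on_compose2[OF ac]) (auto intro!: continuous_intros)
  have "continuous_on S z"
    unfolding continuous_on_eq_continuous_within by (intro ballI has_vector_derivative_continuous[OF z])
  then have z1: "continuous_on (S \<times> X) (\<lambda>p. z (fst p))"
    by (rule continuous_on_compose2) (auto intro!: continuous_intros)
  have z2: "continuous_on (S \<times> X) (\<lambda>p. z' (fst p))"
    by (rule continuous_on_compose2[OF zc]) (auto intro!: continuous_intros)
  have "((\<lambda>p. a (snd p) *\<^sub>R z (fst p)) has_derivative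
      (\<lambda>q. fst q *\<^sub>R a x *\<^sub>R z' t + snd q *\<^sub>R a' x *\<^sub>R z t)) (at (t, x) within S \<times> X)" if "t \<in> S" for t x
  proof (rule has_derivative_eq_rhs)
    have "((\<lambda>p. a (snd p)) has_derivative (\<lambda>q. snd q *\<^sub>R a' x)) (at (t, x) within S \<times> X)"
      using has_derivative_compose[of snd snd "(t, x)" "S \<times> X" a "\<lambda>h. h * a' x"] a[of x]
      by (simp add: has_field_derivative_def mult.commute[of _ "a' x"] bounded_linear_imp_has_derivative bounded_linear_snd)
    moreover have "((\<lambda>p. z (fst p)) has_derivative (\<lambda>q. fst q *\<^sub>R z' t)) (at (t, x) within S \<times> X)"
    proof -
      have "(z has_derivative (\<lambda>h. h *\<^sub>R z' t)) (at t within fst ` (S \<times> X))"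
        using z[OF that] unfolding has_vector_derivative_def by (rule has_derivative_subset) auto
      then show ?thesis
        using has_derivative_in_compose[of fst fst "(t, x)" "S \<times> X" z "\<lambda>h. h *\<^sub>R z' t"]
        by (simp add: bounded_linear_imp_has_derivative bounded_linear_fst)
    qed
    ultimately show "((\<lambda>p. a (snd p) *\<^sub>R z (fst p)) has_derivative
      (\<lambda>q. a (snd (t, x)) *\<^sub>R (fst q *\<^sub>R z' t) + (snd q *\<^sub>R a' x) *\<^sub>R z (fst (t, x)))) (at (t, x) within S \<times> X)"
      by (rule has_derivative_scaleR)
  qed (simp add: fun_eq_iff mult.commute)
  then show ?thesis
    unfolding C1_with_partials_def case_prod_unfold
    by (auto intro!: continuous_intros a1 a2 z1 z2)
qed

lemma bump_polynomial_C1: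
  fixes p :: "real \<Rightarrow> 'b::euclidean_space"
  assumes "polynomial_function p"
  obtains \<phi>' where "continuous_on UNIV \<phi>'"
    "\<And>x. ((\<lambda>x. bump x *\<^sub>R p x) has_vector_derivative \<phi>' x) (at x)"
proof -
  obtain p' where p': "polynomial_function p'" "\<And>x. (p has_vector_derivative (p' x)) (at x)"
    using has_vector_derivative_polynomial_function[OF assms] by blast
  show thesis
  proof (rule that)
    show "continuous_on UNIV (\<lambda>x. bump x *\<^sub>R p' x + (2 * max 0 (x * (1 - x)) * (1 - 2 * x)) *\<^sub>R p x)"
      by (intro continuous_intros continuous_on_bump continuous_on_polymonial_function p' assms)
    show "((\<lambda>x. bump x *\<^sub>R p x) has_vector_derivative
      (bump x *\<^sub>R p' x + (2 * max 0 (x * (1 - x)) * (1 - 2 * x)) *\<^sub>R p x)) (at x)" for x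
      by (intro has_vector_derivative_scaleR bump_has_derivative p')
  qed
qed

lemma in_L2_bump_polynomial:
  fixes p :: "real \<Rightarrow> 'b::euclidean_space"
  assumes "polynomial_function p"
  shows "in_L2 (\<lambda>x. bump x *\<^sub>R p x)"
  by (intro in_L2_continuous continuous_intros continuous_on_bump continuous_on_polymonial_function assms)

text \<open>Extended by \<open>0\<close>, the profile has the same norm over the whole line, where affine substitution is available;
restricting to \<open>{0..1}\<close> afterwards only loses mass.\<close>

lemma L2norm_affine_le:
  fixes \<phi> :: "real \<Rightarrow> 'b::euclidean_space"
  assumes c: "continuous_on UNIV \<phi>" and z: "\<And>x. x \<le> 0 \<or> x \<ge> 1 \<Longrightarrow> \<phi> x = 0" and b: "b \<noteq> 0"
  shows "L2norm (\<lambda>x. \<phi> (a + b * x)) \<le> L2norm \<phi> / sqrt \<bar>b\<bar>"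
proof -
  let ?F = "\<lambda>x. (norm (\<phi> x))\<^sup>2"
  have L: "in_L2 \<phi>" by (rule in_L2_continuous[OF continuous_on_subset[OF c]]) auto
  have L': "in_L2 (\<lambda>x. \<phi> (a + b * x))"
    by (intro in_L2_continuous continuous_on_compose2[OF c] continuous_intros) auto
  have F: "indicat_real {0..1} x *\<^sub>R ?F x = ?F x" for x using z[of x] by (cases "x \<in> {0..1}") (auto simp: indicator_def not_le intro: less_imp_le)
  have "integrable lebesgue (\<lambda>x. indicat_real {0..1} x *\<^sub>R ?F x)"
    using L by (simp add: in_L2_iff integrable_restrict_space)
  then have i: "integrable lebesgue ?F" unfolding F .
  have "(\<integral>x. ?F x \<partial>unit_measure) = (\<integral>x. indicat_real {0..1} x *\<^sub>R ?F x \<partial>lebesgue)"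
    by (simp add: integral_restrict_space)
  then have e: "(\<integral>x. ?F x \<partial>unit_measure) = (\<integral>x. ?F x \<partial>lebesgue)" unfolding F .
  have i2: "integrable lebesgue (\<lambda>x. ?F (a + b * x))"
    using lebesgue_integrable_real_affine[OF i b] .
  have "(\<integral>x. ?F (a + b * x) \<partial>unit_measure) = (\<integral>x. indicat_real {0..1} x *\<^sub>R ?F (a + b * x) \<partial>lebesgue)"
    by (simp add: integral_restrict_space)
  also have "\<dots> \<le> (\<integral>x. ?F (a + b * x) \<partial>lebesgue)"
    by (intro integral_mono i2 integrable_mult_indicator) (auto simp: indicator_def)
  also have "\<dots> = (\<integral>x. ?F x \<partial>lebesgue) / \<bar>b\<bar>"
    using lebesgue_integral_real_affine[OF b, of ?F a] b by (simp add: field_simps)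
  finally show ?thesis unfolding L2norm_eq e real_sqrt_divide[symmetric] by (rule real_sqrt_le_mono)
qed

section \<open>Finite-time extinction of the transported components\<close>

lemma target_solution_identity:
  assumes "target_solution lam1 lam2 \<rho> \<Omega>1 \<Omega>2 \<Psi> N1 N2 N3 \<alpha> \<beta> v" "T > 0"
    and "C1_with_partials ({0..T} \<times> {0..1}) f ft fx"
    and "C1_with_partials ({0..T} \<times> {0..1}) g gt gx"
    and "C1_with_partials ({0..T} \<times> {0..1}) h ht hx"
    and bc: "\<forall>t\<in>{0..T}. lam1 * f t 1 = lam2 * \<rho> * g t 1 \<and> g t 0 = 0"
  shows "(\<integral>x. \<alpha> T x * f T x + \<beta> T x * g T x + v T x \<bullet> h T x \<partial>unit_measure) -
        (\<integral>x. \<alpha> 0 x * f 0 x + \<beta> 0 x * g 0 x + v 0 x \<bullet> h 0 x \<partial>unit_measure) =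
        (LINT t:{0..T}|lebesgue. (\<integral>x.
           \<alpha> t x * (ft t x + lam1 * fx t x) + \<beta> t x * (gt t x - lam2 * gx t x) +
           v t x \<bullet> ht t x + v_rhs \<Omega>1 \<Omega>2 \<Psi> N1 N2 N3 (\<alpha> t) (\<beta> t) (v t) x \<bullet> h t x \<partial>unit_measure))"
proof -
  from assms(1) have "\<forall>T>0. \<forall>f ft fx g gt gx h ht hx.
        C1_with_partials ({0..T} \<times> {0..1}) f ft fx \<and>
        C1_with_partials ({0..T} \<times> {0..1}) g gt gx \<and>
        C1_with_partials ({0..T} \<times> {0..1}) h ht hx \<and>
        (\<forall>t\<in>{0..T}. lam1 * f t 1 = lam2 * \<rho> * g t 1 \<and> g t 0 = 0) \<longrightarrow>
        (\<integral>x. \<alpha> T x * f T x + \<beta> T x * g T x + v T x \<bullet> h T x \<partial>unit_measure) -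
        (\<integral>x. \<alpha> 0 x * f 0 x + \<beta> 0 x * g 0 x + v 0 x \<bullet> h 0 x \<partial>unit_measure) =
        (LINT t:{0..T}|lebesgue. (\<integral>x.
           \<alpha> t x * (ft t x + lam1 * fx t x) + \<beta> t x * (gt t x - lam2 * gx t x) +
           v t x \<bullet> ht t x + v_rhs \<Omega>1 \<Omega>2 \<Psi> N1 N2 N3 (\<alpha> t) (\<beta> t) (v t) x \<bullet> h t x \<partial>unit_measure))"
    unfolding target_solution_def set_lebesgue_integral_unit by (elim conjE)
  from this[rule_format, OF assms(2), of f ft fx g gt gx h ht hx] show ?thesis
    using assms(3-5) bc by blast
qed

lemma target_solution_in_L2:
  assumes "target_solution lam1 lam2 \<rho> \<Omega>1 \<Omega>2 \<Psi> N1 N2 N3 \<alpha> \<beta> v" "t \<ge> 0"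
  shows "in_L2 (\<alpha> t)" "in_L2 (\<beta> t)" "in_L2 (v t)"
  using assms by (auto simp: target_solution_def L2_path_def)

text \<open>Tested with the right-travelling wave \<open>f t x = \<phi> (x + lam1 * (T - t))\<close>, the right-hand side of the weak
identity vanishes. The wave is \<open>0\<close> at \<open>x = 1\<close> up to time \<open>T\<close>, which agrees with \<open>g = 0\<close>.\<close>

lemma alpha_tested:
  fixes p :: "real \<Rightarrow> real"
  assumes sol: "target_solution lam1 lam2 \<rho> \<Omega>1 \<Omega>2 \<Psi> N1 N2 N3 \<alpha> \<beta> v"
    and lam: "lam1 > 0" and T: "T > 0" and p: "polynomial_function p"
  defines "\<phi> \<equiv> \<lambda>x. bump x *\<^sub>R p x"
  shows "(\<integral>x. \<alpha> T x \<bullet> \<phi> x \<partial>unit_measure) = (\<integral>x. \<alpha> 0 x \<bullet> \<phi> (lam1 * T + 1 * x) \<partial>unit_measure)"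
proof -
  obtain \<phi>' where \<phi>': "continuous_on UNIV \<phi>'" "\<And>x. (\<phi> has_vector_derivative \<phi>' x) (at x)"
    using bump_polynomial_C1[OF p] unfolding \<phi>_def by blast
  note f = C1_with_partials_plane_wave[OF \<phi>'(2,1), of "{0..T} \<times> {0..1}" "lam1 * T" "- lam1" 1]
  have bc: "\<phi> (lam1 * T + - lam1 * t + 1 * 1) = 0" if "t \<le> T" for t
  proof -
    have "lam1 * T - lam1 * t \<ge> 0" using lam that by simp
    then show ?thesis by (simp add: \<phi>_def bump_outside)
  qed
  have bc': "\<forall>t\<in>{0..T}. lam1 * \<phi> (lam1 * T + - lam1 * t + 1 * 1) = lam2 * \<rho> * 0 \<and> (0::real) = 0"
    using bc by (auto simp del: mult_1_right)
  have 0: "- lam1 *\<^sub>R y + lam1 * (1 *\<^sub>R y) = 0" for y :: real by simp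
  note I = target_solution_identity[OF sol T f C1_with_partials_0 C1_with_partials_0 bc']
  have e: "lam1 * T + - lam1 * T + 1 * x = x" for x by simp
  show ?thesis
    using I unfolding 0 e mult_zero_right inner_zero_right add_0_right diff_0_right set_lebesgue_integral_def
      Bochner_Integration.integral_zero scaleR_zero_right inner_real_def by (simp only: right_minus_eq)
qed

text \<open>The test function for \<open>\<beta>\<close> is the left-travelling wave \<open>g t x = \<psi> (x - lam2 * (T - t))\<close>. The adjoint boundary
condition at \<open>x = 1\<close> prescribes \<open>f\<close> there, and \<open>f\<close> is continued as a right-travelling wave. At time
\<open>T\<close> the interval holds the part of \<open>f\<close> that passes \<open>x = 1\<close> after \<open>T\<close>; it comes from values of \<open>\<psi>\<close>
to the right of \<open>1\<close>, so it is \<open>0\<close> and \<open>\<alpha> T\<close> does not appear.\<close>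

lemma beta_tested:
  fixes p :: "real \<Rightarrow> real"
  assumes sol: "target_solution lam1 lam2 \<rho> \<Omega>1 \<Omega>2 \<Psi> N1 N2 N3 \<alpha> \<beta> v"
    and lam: "lam1 > 0" "lam2 > 0" and T: "T > 0" and p: "polynomial_function p"
  defines "\<psi> \<equiv> \<lambda>x. bump x *\<^sub>R p x"
  shows "(\<integral>x. \<beta> T x \<bullet> \<psi> x \<partial>unit_measure) =
    (\<integral>x. \<alpha> 0 x * (lam2 * \<rho> / lam1 * \<psi> (1 - lam2 * T + lam2 / lam1 + (- lam2 / lam1) * x))
         + \<beta> 0 x * \<psi> (- lam2 * T + 1 * x) \<partial>unit_measure)"
proof -
  obtain \<psi>' where \<psi>': "continuous_on UNIV \<psi>'" "\<And>x. (\<psi> has_vector_derivative \<psi>' x) (at x)"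
    using bump_polynomial_C1[OF p] unfolding \<psi>_def by blast
  let ?c = "lam2 * \<rho> / lam1"
  have "((\<lambda>y. ?c * \<psi> y) has_vector_derivative ?c * \<psi>' y) (at y)" for y
    using bounded_linear.has_vector_derivative[OF bounded_linear_mult_right \<psi>'(2)] .
  moreover have "continuous_on UNIV (\<lambda>y. ?c * \<psi>' y)" by (intro continuous_intros \<psi>'(1))
  ultimately have f: "C1_with_partials ({0..T} \<times> {0..1})
      (\<lambda>t x. ?c * \<psi> (1 - lam2 * T + lam2 / lam1 + lam2 * t + (- lam2 / lam1) * x))
      (\<lambda>t x. lam2 *\<^sub>R (?c * \<psi>' (1 - lam2 * T + lam2 / lam1 + lam2 * t + (- lam2 / lam1) * x)))
      (\<lambda>t x. (- lam2 / lam1) *\<^sub>R (?c * \<psi>' (1 - lam2 * T + lam2 / lam1 + lam2 * t + (- lam2 / lam1) * x)))"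
    by (rule C1_with_partials_plane_wave)
  note g = C1_with_partials_plane_wave[OF \<psi>'(2,1), of "{0..T} \<times> {0..1}" "- lam2 * T" "lam2" 1]
  have \<psi>0: "\<psi> x = 0" if "x \<le> 0 \<or> x \<ge> 1" for x using bump_outside[OF that] by (simp add: \<psi>_def)
  have bc: "\<forall>t\<in>{0..T}. lam1 * (?c * \<psi> (1 - lam2 * T + lam2 / lam1 + lam2 * t + (- lam2 / lam1) * 1))
      = lam2 * \<rho> * \<psi> (- lam2 * T + lam2 * t + 1 * 1) \<and> \<psi> (- lam2 * T + lam2 * t + 1 * 0) = 0"
  proof (intro ballI conjI)
    fix t assume "t \<in> {0..T}"
    then show "\<psi> (- lam2 * T + lam2 * t + 1 * 0) = 0" using lam by (intro \<psi>0) simp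
    have "1 - lam2 * T + lam2 / lam1 + lam2 * t + (- lam2 / lam1) * 1 = - lam2 * T + lam2 * t + 1 * 1"
      by simp
    then show "lam1 * (?c * \<psi> (1 - lam2 * T + lam2 / lam1 + lam2 * t + (- lam2 / lam1) * 1))
      = lam2 * \<rho> * \<psi> (- lam2 * T + lam2 * t + 1 * 1)"
      using lam by (simp only: times_divide_eq_left) simp
  qed
  have fT: "\<psi> (1 - lam2 * T + lam2 / lam1 + lam2 * T + (- lam2 / lam1) * x) = 0" if "x \<le> 1" for x
  proof (rule \<psi>0, rule disjI2)
    have "lam2 / lam1 * x \<le> lam2 / lam1 * 1" using lam that by (intro mult_left_mono) auto
    then show "1 \<le> 1 - lam2 * T + lam2 / lam1 + lam2 * T + (- lam2 / lam1) * x" by simp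
  qed
  have "(\<integral>x. \<alpha> T x * (?c * \<psi> (1 - lam2 * T + lam2 / lam1 + lam2 * T + (- lam2 / lam1) * x))
       + \<beta> T x * \<psi> (- lam2 * T + lam2 * T + 1 * x) \<partial>unit_measure) = (\<integral>x. \<beta> T x \<bullet> \<psi> x \<partial>unit_measure)"
  proof (rule Bochner_Integration.integral_cong)
    fix x assume "x \<in> space unit_measure"
    then have "x \<le> 1" by (simp add: space_restrict_space)
    then show "\<alpha> T x * (?c * \<psi> (1 - lam2 * T + lam2 / lam1 + lam2 * T + (- lam2 / lam1) * x))
       + \<beta> T x * \<psi> (- lam2 * T + lam2 * T + 1 * x) = \<beta> T x \<bullet> \<psi> x"
      by (subst fT) simp_all
  qed simp
  note fin = this
  have 0: "lam2 *\<^sub>R y + lam1 * ((- lam2 / lam1) *\<^sub>R y) = 0" "lam2 *\<^sub>R y - lam2 * (1 *\<^sub>R y) = 0" for y :: real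
    using lam by simp_all
  note I = target_solution_identity[OF sol T f g C1_with_partials_0 bc]
  show ?thesis
    using I unfolding 0 mult_zero_right inner_zero_right add_0_right set_lebesgue_integral_def
      Bochner_Integration.integral_zero scaleR_zero_right fin by (simp only: right_minus_eq)
qed

text \<open>Before the extinction time \<open>\<tau>\<close> the factor \<open>exp (c * \<tau>) * exp (- c * t)\<close> is at least \<open>1\<close>.\<close>

lemma extinction_imp_exp_bound:
  fixes y :: "real \<Rightarrow> real"
  assumes "\<And>t. t > 0 \<Longrightarrow> y t \<le> K" "y 0 \<le> K" "\<And>t. t > 0 \<Longrightarrow> t \<ge> \<tau> \<Longrightarrow> y t \<le> 0" "K \<ge> 0" "\<tau> > 0" "c > 0" "t \<ge> 0"
  shows "y t \<le> exp (c * \<tau>) * exp (- c * t) * K"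
proof (cases "t \<ge> \<tau>")
  case True
  then have "y t \<le> 0" using assms by auto
  also have "0 \<le> exp (c * \<tau>) * exp (- c * t) * K" using assms by simp
  finally show ?thesis .
next
  case False
  have "y t \<le> 1 * K" using assms by (cases "t = 0") auto
  also have "\<dots> \<le> exp (c * \<tau>) * exp (- c * t) * K"
    using False assms by (intro mult_right_mono) (auto simp: exp_add[symmetric])
  finally show ?thesis .
qed

lemma alpha_decay:
  assumes sol: "target_solution lam1 lam2 \<rho> \<Omega>1 \<Omega>2 \<Psi> N1 N2 N3 \<alpha> \<beta> v"
    and lam: "lam1 > 0" and c: "c > 0" and t: "t \<ge> 0"
  shows "L2norm (\<alpha> t) \<le> exp (c * (1 / lam1)) * exp (- c * t) * L2norm (\<alpha> 0)"
proof (rule extinction_imp_exp_bound[where y = "\<lambda>t. L2norm (\<alpha> t)"])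
  note L = target_solution_in_L2(1)[OF sol]
  fix T :: real assume T: "T > 0"
  have bc: "continuous_on S (\<lambda>x. bump x *\<^sub>R p x)" if "polynomial_function p" for p :: "real \<Rightarrow> real" and S
    by (intro continuous_intros continuous_on_bump continuous_on_polymonial_function that)
  show "L2norm (\<alpha> T) \<le> L2norm (\<alpha> 0)"
  proof (rule L2norm_le_by_testing)
    fix p :: "real \<Rightarrow> real" assume p: "polynomial_function p"
    let ?\<phi> = "\<lambda>x. bump x *\<^sub>R p x"
    have "in_L2 (\<lambda>x. ?\<phi> (lam1 * T + 1 * x))"
      by (intro in_L2_continuous continuous_on_compose2[OF bc[OF p, of UNIV]] continuous_intros) auto
    then have "\<bar>\<integral>x. \<alpha> T x \<bullet> ?\<phi> x \<partial>unit_measure\<bar> \<le> L2norm (\<alpha> 0) * L2norm (\<lambda>x. ?\<phi> (lam1 * T + 1 * x))"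
      unfolding alpha_tested[OF sol lam T p] by (intro inner_L2_le L) auto
    also have "L2norm (\<lambda>x. ?\<phi> (lam1 * T + 1 * x)) \<le> L2norm ?\<phi> / sqrt \<bar>1\<bar>"
      by (intro L2norm_affine_le bc p) (simp_all add: bump_outside)
    finally show "\<bar>\<integral>x. \<alpha> T x \<bullet> ?\<phi> x \<partial>unit_measure\<bar> \<le> L2norm (\<alpha> 0) * L2norm ?\<phi>"
      by (simp add: mult_left_mono)
  qed (use L T in auto)
  assume "T \<ge> 1 / lam1"
  then have T1: "lam1 * T \<ge> 1" using lam by (simp add: field_simps)
  show "L2norm (\<alpha> T) \<le> 0"
  proof (rule L2norm_le_by_testing)
    fix p :: "real \<Rightarrow> real" assume p: "polynomial_function p"
    have "(\<integral>x. \<alpha> 0 x \<bullet> (bump (lam1 * T + 1 * x) *\<^sub>R p (lam1 * T + 1 * x)) \<partial>unit_measure)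
      = (\<integral>x. 0 \<partial>unit_measure)"
      using T1 by (intro Bochner_Integration.integral_cong) (auto simp: space_restrict_space bump_outside)
    then show "\<bar>\<integral>x. \<alpha> T x \<bullet> (bump x *\<^sub>R p x) \<partial>unit_measure\<bar> \<le> 0 * L2norm (\<lambda>x. bump x *\<^sub>R p x)"
      unfolding alpha_tested[OF sol lam T p] by simp
  qed (use L T in auto)
qed (use lam c t in auto)

lemma beta_decay:
  assumes sol: "target_solution lam1 lam2 \<rho> \<Omega>1 \<Omega>2 \<Psi> N1 N2 N3 \<alpha> \<beta> v"
    and lam: "lam1 > 0" "lam2 > 0" and c: "c > 0" and t: "t \<ge> 0"
  shows "L2norm (\<beta> t) \<le> exp (c * (1 / lam1 + 1 / lam2)) * exp (- c * t) *
    (\<bar>lam2 * \<rho> / lam1\<bar> / sqrt (lam2 / lam1) * L2norm (\<alpha> 0) + L2norm (\<beta> 0))"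
proof (rule extinction_imp_exp_bound[where y = "\<lambda>t. L2norm (\<beta> t)"])
  note L = target_solution_in_L2[OF sol]
  fix T :: real assume T: "T > 0"
  have bc: "continuous_on S (\<lambda>x. bump x *\<^sub>R p x)" if "polynomial_function p" for p :: "real \<Rightarrow> real" and S
    by (intro continuous_intros continuous_on_bump continuous_on_polymonial_function that)
  let ?c = "lam2 * \<rho> / lam1"
  let ?a = "1 - lam2 * T + lam2 / lam1"
  show "L2norm (\<beta> T) \<le> \<bar>?c\<bar> / sqrt (lam2 / lam1) * L2norm (\<alpha> 0) + L2norm (\<beta> 0)" (is "_ \<le> ?K")
  proof (rule L2norm_le_by_testing)
    fix p :: "real \<Rightarrow> real" assume p: "polynomial_function p"
    define \<psi> where "\<psi> = (\<lambda>x. bump x *\<^sub>R p x)"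
    define F where "F = (\<lambda>x. \<psi> (?a + (- lam2 / lam1) * x))"
    define G where "G = (\<lambda>x. \<psi> (- lam2 * T + 1 * x))"
    have \<psi>c: "continuous_on S \<psi>" for S unfolding \<psi>_def by (rule bc[OF p])
    have \<psi>0: "\<psi> x = 0" if "x \<le> 0 \<or> x \<ge> 1" for x using bump_outside[OF that] by (simp add: \<psi>_def)
    have F: "in_L2 F" "in_L2 G" unfolding F_def G_def
      by (intro in_L2_continuous continuous_on_compose2[OF \<psi>c[of UNIV]] continuous_intros; simp)+
    have nF: "L2norm F \<le> L2norm \<psi> / sqrt (lam2 / lam1)"
      using L2norm_affine_le[OF \<psi>c \<psi>0, of "- lam2 / lam1" ?a] lam by (simp add: F_def)
    have nG: "L2norm G \<le> L2norm \<psi>"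
      using L2norm_affine_le[OF \<psi>c \<psi>0, of 1 "- lam2 * T"] by (simp add: G_def)
    have "(\<integral>x. \<beta> T x \<bullet> \<psi> x \<partial>unit_measure) = (\<integral>x. ?c * (\<alpha> 0 x \<bullet> F x) + \<beta> 0 x \<bullet> G x \<partial>unit_measure)"
      unfolding \<psi>_def beta_tested[OF sol lam T p] F_def G_def by (simp only: inner_real_def mult.left_commute)
    also have "\<dots> = ?c * (\<integral>x. \<alpha> 0 x \<bullet> F x \<partial>unit_measure) + (\<integral>x. \<beta> 0 x \<bullet> G x \<partial>unit_measure)"
    proof (subst Bochner_Integration.integral_add)
      show "integrable unit_measure (\<lambda>x. ?c * (\<alpha> 0 x \<bullet> F x))"
        by (intro integrable_mult_right integrable_inner_L2 L F) simp
      show "integrable unit_measure (\<lambda>x. \<beta> 0 x \<bullet> G x)"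
        by (intro integrable_inner_L2 L F) simp
    qed simp
    finally have "\<bar>\<integral>x. \<beta> T x \<bullet> \<psi> x \<partial>unit_measure\<bar>
        \<le> \<bar>?c\<bar> * \<bar>\<integral>x. \<alpha> 0 x \<bullet> F x \<partial>unit_measure\<bar> + \<bar>\<integral>x. \<beta> 0 x \<bullet> G x \<partial>unit_measure\<bar>"
      by (simp only: abs_mult[symmetric] abs_triangle_ineq)
    also have "\<dots> \<le> \<bar>?c\<bar> * (L2norm (\<alpha> 0) * L2norm F) + L2norm (\<beta> 0) * L2norm G"
      by (intro add_mono mult_left_mono inner_L2_le L F) simp_all
    also have "\<dots> \<le> \<bar>?c\<bar> * (L2norm (\<alpha> 0) * (L2norm \<psi> / sqrt (lam2 / lam1))) + L2norm (\<beta> 0) * L2norm \<psi>"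
      by (intro add_mono mult_left_mono nF nG) simp_all
    also have "\<dots> = ?K * L2norm \<psi>" by (simp add: algebra_simps)
    finally show "\<bar>\<integral>x. \<beta> T x \<bullet> (bump x *\<^sub>R p x) \<partial>unit_measure\<bar> \<le> ?K * L2norm (\<lambda>x. bump x *\<^sub>R p x)"
      by (simp only: \<psi>_def)
  qed (use L T lam in auto)
  assume T1: "T \<ge> 1 / lam1 + 1 / lam2"
  have "lam2 * (1 / lam1 + 1 / lam2) \<le> lam2 * T" using lam by (intro mult_left_mono T1) auto
  then have T2: "lam2 * T \<ge> 1 + lam2 / lam1" using lam by (simp add: algebra_simps)
  show "L2norm (\<beta> T) \<le> 0"
  proof (rule L2norm_le_by_testing)
    fix p :: "real \<Rightarrow> real" assume p: "polynomial_function p"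
    have 1: "bump (?a + (- lam2 / lam1) * x) = 0" if "0 \<le> x" for x
    proof -
      have "lam2 / lam1 * x \<ge> 0" using lam that by simp
      then show ?thesis using T2 by (intro bump_outside) simp
    qed
    have 2: "bump (- lam2 * T + 1 * x) = 0" if "x \<le> 1" for x
    proof -
      have "lam2 / lam1 > 0" using lam by simp
      then show ?thesis using T2 that by (intro bump_outside) simp
    qed
    have "(\<integral>x. \<beta> T x \<bullet> (bump x *\<^sub>R p x) \<partial>unit_measure) = (\<integral>x. 0 \<partial>unit_measure)"
      unfolding beta_tested[OF sol lam T p]
    proof (rule Bochner_Integration.integral_cong[OF refl])
      fix x assume "x \<in> space unit_measure"
      then have x: "0 \<le> x" "x \<le> 1" by (auto simp: space_restrict_space)
      show "\<alpha> 0 x * (?c * (bump (?a + (- lam2 / lam1) * x) *\<^sub>R p (?a + (- lam2 / lam1) * x)))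
         + \<beta> 0 x * (bump (- lam2 * T + 1 * x) *\<^sub>R p (- lam2 * T + 1 * x)) = 0"
        by (simp only: 1[OF x(1)] 2[OF x(2)] scaleR_zero_left mult_zero_right add_0_right)
    qed
    then show "\<bar>\<integral>x. \<beta> T x \<bullet> (bump x *\<^sub>R p x) \<partial>unit_measure\<bar> \<le> 0 * L2norm (\<lambda>x. bump x *\<^sub>R p x)"
      by simp
  qed (use L T in auto)
qed (use lam c t in \<open>auto intro!: add_nonneg_nonneg add_pos_pos\<close>)

section \<open>Stability of the ODE component\<close>

text \<open>Since the Bochner integral of a non-integrable function is \<open>0\<close>, domination by an integrable function
suffices for the bound. This spares measurability arguments for the Volterra terms as functions of
\<open>x\<close> and for the space integrals as functions of \<open>t\<close>.\<close>

lemma norm_integral_le_dominated: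
  fixes f :: "'a \<Rightarrow> 'b::{banach, second_countable_topology}"
  assumes g: "integrable M g" and le: "\<And>x. x \<in> space M \<Longrightarrow> norm (f x) \<le> g x"
  shows "norm (\<integral>x. f x \<partial>M) \<le> (\<integral>x. g x \<partial>M)"
proof (cases "integrable M f")
  case True
  then show ?thesis using g le 
    by (intro order_trans[OF integral_norm_bound] integral_mono) auto
next
  case False
  have "0 \<le> (\<integral>x. g x \<partial>M)"
    by (intro integral_nonneg_AE AE_I2 order_trans[OF norm_ge_zero le])
  then show ?thesis using False by (simp add: not_integrable_integral_eq)
qed

lemma norm_set_integral_le_dominated:
  fixes f :: "'a \<Rightarrow> 'b::{banach, second_countable_topology}"
  assumes g: "set_integrable M S g" and le: "\<And>x. x \<in> S \<Longrightarrow> norm (f x) \<le> g x"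
  shows "norm (LINT x:S|M. f x) \<le> (LINT x:S|M. g x)"
  unfolding set_lebesgue_integral_def
  by (rule norm_integral_le_dominated)
     (use g le in \<open>auto simp: set_integrable_def indicator_def\<close>)

lemma set_integrable_tail:
  assumes "in_L2 f" "0 \<le> x"
  shows "set_integrable lebesgue {x..1} (\<lambda>y. norm (f y))"
  by (rule set_integrable_subset[of _ "{0..1}"])
     (use assms integrable_norm_L2 in \<open>auto simp: set_integrable_unit\<close>)

lemma set_lebesgue_integral_tail:
  fixes f :: "real \<Rightarrow> real"
  assumes "0 \<le> x"
  shows "(LINT y:{x..1}|lebesgue. f y) = (\<integral>y. indicat_real {x..1} y * f y \<partial>unit_measure)"
proof -
  have "indicat_real {x..1} y *\<^sub>R f y = indicat_real {0..1} y *\<^sub>R (indicat_real {x..1} y * f y)" for y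
    using assms by (auto simp: indicator_def)
  then show ?thesis unfolding set_lebesgue_integral_unit[symmetric] set_lebesgue_integral_def
    by (simp only: real_scaleR_def)
qed

lemma tail_integral_le_L2norm:
  assumes "in_L2 f" "0 \<le> x"
  shows "(LINT y:{x..1}|lebesgue. norm (f y)) \<le> L2norm f"
proof -
  have i: "integrable unit_measure (\<lambda>y. norm (f y))" using assms by (rule_tac integrable_norm_L2)
  have m: "{x..1} \<in> sets unit_measure"
    using assms(2) by (auto simp: sets_restrict_space_iff)
  have "(LINT y:{x..1}|lebesgue. norm (f y)) \<le> (\<integral>y. norm (f y) \<partial>unit_measure)"
    unfolding set_lebesgue_integral_tail[OF assms(2)]
    by (rule integral_mono[OF _ i])
       (use integrable_mult_indicator[OF m i] in \<open>auto simp: indicator_def\<close>)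
  also have "\<dots> \<le> L2norm f" by (rule L1_le_L2norm[OF assms(1)])
  finally show ?thesis .
qed

text \<open>Write \<open>w\<close> as \<open>exp (- k * y)\<close> times its weighted version and use Cauchy-Schwarz; the square of the \<open>L\<^sup>2\<close> norm of
\<open>exp (- k * y)\<close> over \<open>{x..1}\<close> is at most \<open>exp (- 2 * k * x) / (2 * k)\<close>. The factor \<open>exp (- k * x)\<close> cancels the
weight at \<open>x\<close>, and \<open>1 / sqrt (2 * k)\<close> is the gain.\<close>

lemma weighted_tail_integral_le:
  fixes w :: "real \<Rightarrow> 'b::euclidean_space"
  assumes w: "in_L2 w" and k: "k > 0" and x: "0 \<le> x" "x \<le> 1"
  shows "(LINT y:{x..1}|lebesgue. norm (w y)) \<le> exp (- k * x) / sqrt (2 * k) * L2norm (\<lambda>y. exp (k * y) *\<^sub>R w y)"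
proof -
  define e where "e = (\<lambda>y. indicat_real {x..1} y * exp (- k * y))"
  define W where "W = (\<lambda>y. exp (k * y) *\<^sub>R w y)"
  have W: "in_L2 W" unfolding W_def by (intro in_L2_scaleR_continuous w continuous_intros)
  have [measurable]: "(\<lambda>y::real. exp (- k * y)) \<in> borel_measurable unit_measure"
    by (intro continuous_borel_measurable_unit continuous_intros)
  have [measurable]: "indicat_real {x..1} \<in> borel_measurable unit_measure"
    using x by (intro borel_measurable_indicator) (auto simp: sets_restrict_space_iff)
  have e: "in_L2 e"
  proof (rule in_L2_bounded[where B = 1])
    show "e \<in> borel_measurable unit_measure" unfolding e_def by measurable
  qed (use k in \<open>auto simp: e_def indicator_def\<close>)
  have "(L2norm e)\<^sup>2 = (\<integral>y. indicat_real {x..1} y * exp (- (2 * k) * y) \<partial>unit_measure)"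
    unfolding L2norm_power2
    by (intro Bochner_Integration.integral_cong) (auto simp: e_def indicator_def exp_add[symmetric] power2_eq_square)
  also have "\<dots> = (LINT y:{x..1}|lebesgue. exp (- (2 * k) * y))"
    by (rule set_lebesgue_integral_tail[OF x(1), symmetric])
  also have "\<dots> = integral {x..1} (\<lambda>y. exp (- (2 * k) * y))"
  proof (rule set_lebesgue_integral_eq_integral)
    have "in_L2 (\<lambda>y. exp (- (2 * k) * y))" by (intro in_L2_continuous continuous_intros)
    from set_integrable_tail[OF this x(1)]
    show "set_integrable lebesgue {x..1} (\<lambda>y. exp (- (2 * k) * y))" by simp
  qed
  also have "\<dots> = exp (- (2 * k) * 1) / (- (2 * k)) - exp (- (2 * k) * x) / (- (2 * k))"
    by (intro integral_unique fundamental_theorem_of_calculus)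
       (use x k in \<open>auto intro!: derivative_eq_intros simp: has_real_derivative_iff_has_vector_derivative[symmetric]\<close>)
  also have "\<dots> \<le> exp (- (2 * k) * x) / (2 * k)" using k by simp
  also have "\<dots> = (exp (- k * x) / sqrt (2 * k))\<^sup>2"
    using k by (simp add: power_divide exp_add[symmetric] power2_eq_square)
  finally have ne: "L2norm e \<le> exp (- k * x) / sqrt (2 * k)"
    by (rule power2_le_imp_le) (use k in simp)
  have "(LINT y:{x..1}|lebesgue. norm (w y)) = (\<integral>y. norm (e y) * norm (W y) \<partial>unit_measure)"
    unfolding set_lebesgue_integral_tail[OF x(1)]
    by (intro Bochner_Integration.integral_cong) (auto simp: e_def W_def indicator_def exp_minus)
  also have "\<dots> \<le> L2norm e * L2norm W" by (rule L2_Cauchy_Schwarz[OF e W])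
  also have "\<dots> \<le> exp (- k * x) / sqrt (2 * k) * L2norm W" by (intro mult_right_mono ne) simp
  finally show ?thesis by (simp add: W_def)
qed

lemma kernel_integral_le:
  fixes N :: "real \<Rightarrow> 'a::{banach, second_countable_topology}"
  assumes "in_L2 f" "0 \<le> x" "\<And>y. x \<le> y \<Longrightarrow> y \<le> 1 \<Longrightarrow> norm (N y) \<le> B * norm (f y)"
  shows "norm (LINT y:{x..1}|lebesgue. N y) \<le> B * (LINT y:{x..1}|lebesgue. norm (f y))"
proof -
  have "norm (LINT y:{x..1}|lebesgue. N y) \<le> (LINT y:{x..1}|lebesgue. B * norm (f y))"
    by (rule norm_set_integral_le_dominated)
       (use assms set_integrable_tail[OF assms(1,2)] in auto)
  then show ?thesis by simp
qed

definition kernels_bounded_by ::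
    "real \<Rightarrow> (real \<Rightarrow> real \<Rightarrow> real^'n) \<Rightarrow> (real \<Rightarrow> real \<Rightarrow> real^'n) \<Rightarrow> (real \<Rightarrow> real \<Rightarrow> real^'n^'n) \<Rightarrow> bool" where
  "kernels_bounded_by B N1 N2 N3 \<longleftrightarrow> B \<ge> 0 \<and>
     (\<forall>(x, y)\<in>kernel_domain. norm (N1 x y) \<le> B \<and> norm (N2 x y) \<le> B \<and>
        (\<forall>w. norm (N3 x y *v w) \<le> B * norm w))"

text \<open>\<open>H\<close> is the adjoint test function at a fixed time, whose size carries the weight \<open>exp (k * x)\<close>. For the
terms with \<open>a\<close> and \<open>b\<close> this weight is estimated by \<open>exp k\<close>; for the Volterra term in \<open>w\<close> it is needed to
express everything through the weighted norm with the small factor.\<close>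

lemma forcing_estimate:
  fixes \<Omega>1 \<Omega>2 :: "real^'n"
  assumes kb: "kernels_bounded_by B N1 N2 N3" and k: "k > 0" and m: "m \<ge> 0"
    and L: "in_L2 a" "in_L2 b" "in_L2 w" "in_L2 \<phi>"
    and H: "\<And>x. 0 \<le> x \<Longrightarrow> x \<le> 1 \<Longrightarrow> norm (H x) \<le> exp (k * x) * m * norm (\<phi> x)"
  defines "D \<equiv> norm \<Omega>1 + norm \<Omega>2 + B"
  shows "\<bar>\<integral>x. (v_rhs \<Omega>1 \<Omega>2 \<Psi> N1 N2 N3 a b w x - \<Psi> *v w x) \<bullet> H x \<partial>unit_measure\<bar>
    \<le> m * (2 * exp k * D * (L2norm a + L2norm b) + B / sqrt (2 * k) * L2norm (\<lambda>x. exp (k * x) *\<^sub>R w x)) * L2norm \<phi>"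
proof -
  define nW where "nW = L2norm (\<lambda>x. exp (k * x) *\<^sub>R w x)"
  define R where "R = (\<lambda>x. v_rhs \<Omega>1 \<Omega>2 \<Psi> N1 N2 N3 a b w x - \<Psi> *v w x)"
  define E where "E = exp k * D"
  define e where "e = B / sqrt (2 * k) * nW"
  define s where "s = L2norm a + L2norm b"
  have B: "B \<ge> 0" using kb by (simp add: kernels_bounded_by_def)
  have D: "D \<ge> 0" "norm \<Omega>1 \<le> D" "norm \<Omega>2 \<le> D" "B \<le> D" using B by (auto simp: D_def)
  have e0: "e \<ge> 0" using B k by (simp add: e_def nW_def)
  have E0: "E \<ge> 0" using D by (simp add: E_def)
  have s0: "s \<ge> 0" by (simp add: s_def)
  have R: "norm (R x) \<le> D * (\<bar>a x\<bar> + \<bar>b x\<bar> + s) + exp (- k * x) * e" if x: "0 \<le> x" "x \<le> 1" for x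
  proof -
    have kb': "norm (N1 x y) \<le> B" "norm (N2 x y) \<le> B" "norm (N3 x y *v u) \<le> B * norm u" if "x \<le> y" "y \<le> 1" for y u
      using kb x that by (auto simp: kernels_bounded_by_def kernel_domain_def)
    let ?I1 = "LINT \<xi>:{x..1}|lebesgue. a \<xi> *\<^sub>R N1 x \<xi>"
    let ?I2 = "LINT \<xi>:{x..1}|lebesgue. b \<xi> *\<^sub>R N2 x \<xi>"
    let ?I3 = "LINT \<xi>:{x..1}|lebesgue. N3 x \<xi> *v w \<xi>"
    have "norm ?I1 \<le> B * (LINT y:{x..1}|lebesgue. norm (a y))"
      by (intro kernel_integral_le L x) (simp add: mult.commute[of B] mult_left_mono kb'(1))
    also have "\<dots> \<le> B * L2norm a" by (intro mult_left_mono tail_integral_le_L2norm L x B)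
    also have "\<dots> \<le> D * L2norm a" by (intro mult_right_mono D) simp
    finally have 1: "norm ?I1 \<le> D * L2norm a" .
    have "norm ?I2 \<le> B * (LINT y:{x..1}|lebesgue. norm (b y))"
      by (intro kernel_integral_le L x) (simp add: mult.commute[of B] mult_left_mono kb'(2))
    also have "\<dots> \<le> B * L2norm b" by (intro mult_left_mono tail_integral_le_L2norm L x B)
    also have "\<dots> \<le> D * L2norm b" by (intro mult_right_mono D) simp
    finally have 2: "norm ?I2 \<le> D * L2norm b" .
    have "norm ?I3 \<le> B * (LINT y:{x..1}|lebesgue. norm (w y))"
      by (intro kernel_integral_le L x kb'(3))
    also have "\<dots> \<le> B * (exp (- k * x) / sqrt (2 * k) * nW)"
      unfolding nW_def by (intro mult_left_mono weighted_tail_integral_le L k x B)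
    finally have 3: "norm ?I3 \<le> exp (- k * x) * e" by (simp add: e_def mult_ac)
    have 4: "norm (a x *\<^sub>R \<Omega>1) \<le> D * \<bar>a x\<bar>" "norm (b x *\<^sub>R \<Omega>2) \<le> D * \<bar>b x\<bar>"
      using D by (simp_all add: mult.commute[of D] mult_left_mono)
    have "R x = a x *\<^sub>R \<Omega>1 + b x *\<^sub>R \<Omega>2 + ?I1 + ?I2 + ?I3"
      by (simp add: R_def v_rhs_def algebra_simps)
    also have "norm \<dots> \<le> norm (a x *\<^sub>R \<Omega>1) + norm (b x *\<^sub>R \<Omega>2) + norm ?I1 + norm ?I2 + norm ?I3"
      by (intro norm_triangle_le add_mono order_refl)
    also have "\<dots> \<le> D * \<bar>a x\<bar> + D * \<bar>b x\<bar> + D * L2norm a + D * L2norm b + exp (- k * x) * e"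
      by (intro add_mono 1 2 3 4)
    finally show ?thesis by (simp add: s_def algebra_simps)
  qed
  define g where "g = (\<lambda>x. m * E * (norm (a x) * norm (\<phi> x)) + m * E * (norm (b x) * norm (\<phi> x))
      + m * (E * s + e) * norm (\<phi> x))"
  have "norm (R x \<bullet> H x) \<le> g x" if x: "0 \<le> x" "x \<le> 1" for x
  proof -
    have "norm (R x \<bullet> H x) \<le> norm (R x) * norm (H x)" by (simp add: Cauchy_Schwarz_ineq2)
    also have "\<dots> \<le> (D * (\<bar>a x\<bar> + \<bar>b x\<bar> + s) + exp (- k * x) * e) * (exp (k * x) * m * norm (\<phi> x))"
      by (intro mult_mono R H x add_nonneg_nonneg mult_nonneg_nonneg D e0 s0) simp_all
    also have "\<dots> = (exp (k * x) * D * (\<bar>a x\<bar> + \<bar>b x\<bar> + s) + (exp (- k * x) * exp (k * x)) * e) * m * norm (\<phi> x)"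
      by (simp only: algebra_simps)
    also have "exp (- k * x) * exp (k * x) = 1" by (simp add: exp_add[symmetric])
    also have "(exp (k * x) * D * (\<bar>a x\<bar> + \<bar>b x\<bar> + s) + 1 * e) * m * norm (\<phi> x)
      \<le> (E * (\<bar>a x\<bar> + \<bar>b x\<bar> + s) + 1 * e) * m * norm (\<phi> x)"
      unfolding E_def using x k D m s0 by (intro mult_right_mono add_right_mono) auto
    also have "\<dots> = g x" by (simp add: g_def algebra_simps)
    finally show ?thesis .
  qed
  moreover have gi: "integrable unit_measure g"
    unfolding g_def
    by (intro Bochner_Integration.integrable_add integrable_mult_right integrable_L2_product integrable_norm_L2 L)
  ultimately have "\<bar>\<integral>x. R x \<bullet> H x \<partial>unit_measure\<bar> \<le> (\<integral>x. g x \<partial>unit_measure)"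
    using norm_integral_le_dominated[of unit_measure g "\<lambda>x. R x \<bullet> H x"] by (simp add: space_restrict_space)
  also have "\<dots> = m * E * (\<integral>x. norm (a x) * norm (\<phi> x) \<partial>unit_measure)
     + m * E * (\<integral>x. norm (b x) * norm (\<phi> x) \<partial>unit_measure) + m * (E * s + e) * (\<integral>x. norm (\<phi> x) \<partial>unit_measure)"
    unfolding g_def
    by (simp add: Bochner_Integration.integral_add Bochner_Integration.integrable_add
        integrable_L2_product[OF L(1,4)] integrable_L2_product[OF L(2,4)] integrable_norm_L2[OF L(4)]
        integrable_L2_product[OF L(1,4), simplified] integrable_L2_product[OF L(2,4), simplified])
  also have "\<dots> \<le> m * E * (L2norm a * L2norm \<phi>) + m * E * (L2norm b * L2norm \<phi>) + m * (E * s + e) * L2norm \<phi>"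
    by (intro add_mono mult_left_mono L2_Cauchy_Schwarz L1_le_L2norm L mult_nonneg_nonneg add_nonneg_nonneg m E0 s0 e0)
  also have "\<dots> = m * (2 * E * s + e) * L2norm \<phi>" by (simp add: s_def algebra_simps)
  finally show ?thesis by (simp add: R_def E_def e_def s_def nW_def mult.assoc)
qed

lemma vector_matrix_mult_sum_scaleR:
  fixes A :: "real^'n^'m"
  shows "(\<Sum>i\<in>I. c i *\<^sub>R y i) v* A = (\<Sum>i\<in>I. c i *\<^sub>R (y i v* A))"
  unfolding transpose_matrix_vector[symmetric]
  by (simp only: linear_sum[OF matrix_vector_mul_linear] linear_cmul[OF matrix_vector_mul_linear])

text \<open>Variation of constants, tested. The function \<open>H\<close> solves the adjoint ODE \<open>\<partial>\<^sub>t H = - H v* \<Psi>\<close> with the final value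
\<open>exp (k * x) *\<^sub>R \<phi> x\<close>, so the term \<open>\<Psi> *v v\<close> drops out of the right-hand side.\<close>

lemma v_tested:
  fixes \<Psi> :: "real^'n^'n" and z :: "'n \<Rightarrow> real \<Rightarrow> real^'n" and p :: "real \<Rightarrow> real^'n" and k :: real
  assumes sol: "target_solution lam1 lam2 \<rho> \<Omega>1 \<Omega>2 \<Psi> N1 N2 N3 \<alpha> \<beta> v"
    and T: "T > 0" and p: "polynomial_function p"
    and z0: "\<And>i. z i 0 = axis i 1"
    and zd: "\<And>i t. t \<ge> 0 \<Longrightarrow> (z i has_vector_derivative z i t v* \<Psi>) (at t within {0..})"
  defines "\<phi> \<equiv> \<lambda>x. bump x *\<^sub>R p x"
  defines "H \<equiv> \<lambda>t x. \<Sum>i\<in>UNIV. (exp (k * x) * \<phi> x $ i) *\<^sub>R z i (T - t)"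
  shows "(\<integral>x. (exp (k * x) *\<^sub>R v T x) \<bullet> \<phi> x \<partial>unit_measure) - (\<integral>x. v 0 x \<bullet> H 0 x \<partial>unit_measure)
    = (LINT t:{0..T}|lebesgue. \<integral>x. (v_rhs \<Omega>1 \<Omega>2 \<Psi> N1 N2 N3 (\<alpha> t) (\<beta> t) (v t) x - \<Psi> *v v t x) \<bullet> H t x \<partial>unit_measure)"
proof -
  obtain \<phi>' where \<phi>': "continuous_on UNIV \<phi>'" "\<And>x. (\<phi> has_vector_derivative \<phi>' x) (at x)"
    using bump_polynomial_C1[OF p] unfolding \<phi>_def by blast
  define a' where "a' = (\<lambda>i x. exp (k * x) * \<phi>' x $ i + k * exp (k * x) * \<phi> x $ i)"
  define H' where "H' = (\<lambda>t x. \<Sum>i\<in>UNIV. (exp (k * x) * \<phi> x $ i) *\<^sub>R (- (z i (T - t) v* \<Psi>)))"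
  have \<phi>c: "continuous_on UNIV \<phi>"
    unfolding \<phi>_def by (intro continuous_intros continuous_on_bump continuous_on_polymonial_function p)
  have zc: "continuous_on {0..} (z i)" for i
    unfolding continuous_on_eq_continuous_within by (intro ballI has_vector_derivative_continuous[OF zd]) simp
  have "C1_with_partials ({0..T} \<times> {0..1}) H H' (\<lambda>t x. \<Sum>i\<in>UNIV. a' i x *\<^sub>R z i (T - t))"
    unfolding H_def H'_def
  proof (intro C1_with_partials_sum C1_with_partials_product)
    fix i :: 'n
    show "((\<lambda>x. exp (k * x) * \<phi> x $ i) has_real_derivative a' i x) (at x)" for x
    proof -
      have "((\<lambda>x. \<phi> x $ i) has_real_derivative \<phi>' x $ i) (at x)"
        using bounded_linear.has_vector_derivative[OF bounded_linear_vec_nth \<phi>'(2)]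
        by (simp add: has_real_derivative_iff_has_vector_derivative)
      then show ?thesis unfolding a'_def by (auto intro!: derivative_eq_intros)
    qed
    show "continuous_on UNIV (a' i)"
      unfolding a'_def by (intro continuous_intros \<phi>'(1) \<phi>c)
    show "((\<lambda>t. z i (T - t)) has_vector_derivative - (z i (T - t) v* \<Psi>)) (at t within {0..T})"
      if "t \<in> {0..T}" for t
    proof -
      have "((\<lambda>t. T - t) has_vector_derivative - 1) (at t within {0..T})"
        by (auto intro!: derivative_eq_intros)
      moreover have "(z i has_vector_derivative z i (T - t) v* \<Psi>) (at (T - t) within (\<lambda>t. T - t) ` {0..T})"
        by (rule has_vector_derivative_within_subset[OF zd]) (use that in auto)
      ultimately show ?thesis
        using vector_diff_chain_within[of "\<lambda>t. T - t" "- 1" t "{0..T}" "z i"] by (simp add: o_def)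
    qed
    show "continuous_on {0..T} (\<lambda>t. - (z i (T - t) v* \<Psi>))"
      unfolding transpose_matrix_vector[symmetric]
      by (intro continuous_intros bounded_linear.continuous_on[OF matrix_vector_mul_bounded_linear]
          continuous_on_compose2[OF zc]) auto
  qed simp
  moreover have "\<forall>t\<in>{0..T}. lam1 * (0::real) = lam2 * \<rho> * 0 \<and> (0::real) = 0" by simp
  ultimately have I: "(\<integral>x. \<alpha> T x * 0 + \<beta> T x * 0 + v T x \<bullet> H T x \<partial>unit_measure) -
        (\<integral>x. \<alpha> 0 x * 0 + \<beta> 0 x * 0 + v 0 x \<bullet> H 0 x \<partial>unit_measure) =
        (LINT t:{0..T}|lebesgue. (\<integral>x.
           \<alpha> t x * (0 + lam1 * 0) + \<beta> t x * (0 - lam2 * 0) +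
           v t x \<bullet> H' t x + v_rhs \<Omega>1 \<Omega>2 \<Psi> N1 N2 N3 (\<alpha> t) (\<beta> t) (v t) x \<bullet> H t x \<partial>unit_measure))"
    by (rule target_solution_identity[OF sol T C1_with_partials_0 C1_with_partials_0])
  have HT: "v T x \<bullet> H T x = (exp (k * x) *\<^sub>R v T x) \<bullet> \<phi> x" for x
  proof -
    have "H T x = (\<Sum>i\<in>UNIV. (exp (k * x) * \<phi> x $ i) *s axis i 1)"
      by (simp add: H_def z0 scalar_mult_eq_scaleR)
    also have "\<dots> = exp (k * x) *\<^sub>R \<phi> x"
      using basis_expansion[of "exp (k * x) *\<^sub>R \<phi> x"] by simp
    finally show ?thesis by simp
  qed
  have adj: "v t x \<bullet> H' t x = - (\<Psi> *v v t x) \<bullet> H t x" for t x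
  proof -
    have "H' t x = - (H t x v* \<Psi>)"
      by (simp add: H_def H'_def vector_matrix_mult_sum_scaleR sum_negf)
    then show ?thesis
      using dot_lmul_matrix[of "H t x" \<Psi> "v t x"] by (simp add: inner_commute[of "v t x"] inner_commute[of "\<Psi> *v v t x"])
  qed
  have pt: "v t x \<bullet> H' t x + v_rhs \<Omega>1 \<Omega>2 \<Psi> N1 N2 N3 (\<alpha> t) (\<beta> t) (v t) x \<bullet> H t x
     = (v_rhs \<Omega>1 \<Omega>2 \<Psi> N1 N2 N3 (\<alpha> t) (\<beta> t) (v t) x - \<Psi> *v v t x) \<bullet> H t x" for t x
    by (simp add: adj inner_diff_left)
  show ?thesis using I unfolding HT mult_zero_right add_0 add_0_right diff_0_right pt .
qed

text \<open>The semigroup decays at rate \<open>2 * g\<close>, the forcing at rate \<open>g\<close>. Their convolution is at most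
\<open>exp (- g * T) / g\<close>.\<close>

lemma v_duhamel_bound:
  fixes \<Psi> :: "real^'n^'n" and z :: "'n \<Rightarrow> real \<Rightarrow> real^'n"
  assumes sol: "target_solution lam1 lam2 \<rho> \<Omega>1 \<Omega>2 \<Psi> N1 N2 N3 \<alpha> \<beta> v"
    and T: "T > 0" and kb: "kernels_bounded_by B N1 N2 N3" and k: "k > 0"
    and M: "M > 0" and g: "g > 0"
    and z0: "\<And>i. z i 0 = axis i 1"
    and zd: "\<And>i t. t \<ge> 0 \<Longrightarrow> (z i has_vector_derivative z i t v* \<Psi>) (at t within {0..})"
    and zb: "\<And>t w. t \<ge> 0 \<Longrightarrow> norm (\<Sum>i\<in>UNIV. w $ i *\<^sub>R z i t) \<le> M * exp (- (2 * g) * t) * norm w"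
  defines "W \<equiv> \<lambda>t x. exp (k * x) *\<^sub>R v t x"
  assumes F: "\<And>t. 0 \<le> t \<Longrightarrow> t \<le> T \<Longrightarrow>
      2 * exp k * (norm \<Omega>1 + norm \<Omega>2 + B) * (L2norm (\<alpha> t) + L2norm (\<beta> t)) + B / sqrt (2 * k) * L2norm (W t)
      \<le> Q * exp (- g * t)"
  shows "L2norm (W T) \<le> exp (- g * T) * (M * L2norm (W 0) + M * Q / g)"
proof (rule L2norm_le_by_testing)
  note L = target_solution_in_L2[OF sol]
  have WL: "in_L2 (W t)" if "t \<ge> 0" for t
    unfolding W_def by (intro in_L2_scaleR_continuous continuous_intros L that)
  show "in_L2 (W T)" using T by (intro WL) simp
  have "0 \<le> 2 * exp k * (norm \<Omega>1 + norm \<Omega>2 + B) * (L2norm (\<alpha> 0) + L2norm (\<beta> 0)) + B / sqrt (2 * k) * L2norm (W 0)"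
    using kb k by (intro add_nonneg_nonneg mult_nonneg_nonneg divide_nonneg_nonneg) (auto simp: kernels_bounded_by_def)
  also have "\<dots> \<le> Q" using F[of 0] T by simp
  finally have Q: "Q \<ge> 0" .
  show "0 \<le> exp (- g * T) * (M * L2norm (W 0) + M * Q / g)" using M g Q by simp
  fix p :: "real \<Rightarrow> real^'n" assume p: "polynomial_function p"
  define \<phi> where "\<phi> = (\<lambda>x. bump x *\<^sub>R p x)"
  have \<phi>: "in_L2 \<phi>" unfolding \<phi>_def by (rule in_L2_bump_polynomial[OF p])
  define H where "H = (\<lambda>t x. \<Sum>i\<in>UNIV. (exp (k * x) * \<phi> x $ i) *\<^sub>R z i (T - t))"
  define J where "J = (\<lambda>t. \<integral>x. (v_rhs \<Omega>1 \<Omega>2 \<Psi> N1 N2 N3 (\<alpha> t) (\<beta> t) (v t) x - \<Psi> *v v t x) \<bullet> H t x \<partial>unit_measure)"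
  have I: "(\<integral>x. W T x \<bullet> \<phi> x \<partial>unit_measure) - (\<integral>x. v 0 x \<bullet> H 0 x \<partial>unit_measure) = (LINT t:{0..T}|lebesgue. J t)"
    unfolding W_def J_def H_def \<phi>_def by (rule v_tested[OF sol T p z0 zd])
  have Hb: "norm (H t x) \<le> exp (k * x) * (M * exp (- (2 * g) * (T - t))) * norm (\<phi> x)" if "t \<le> T" for t x
    using zb[of "T - t" "exp (k * x) *\<^sub>R \<phi> x"] that by (simp add: H_def mult_ac)
  have "\<bar>\<integral>x. v 0 x \<bullet> H 0 x \<partial>unit_measure\<bar> \<le> (\<integral>x. M * exp (- (2 * g) * T) * (norm (W 0 x) * norm (\<phi> x)) \<partial>unit_measure)"
  proof -
    have "norm (v 0 x \<bullet> H 0 x) \<le> M * exp (- (2 * g) * T) * (norm (W 0 x) * norm (\<phi> x))" for x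
    proof -
      have "norm (v 0 x \<bullet> H 0 x) \<le> norm (v 0 x) * norm (H 0 x)" by (simp add: Cauchy_Schwarz_ineq2)
      also have "\<dots> \<le> norm (v 0 x) * (exp (k * x) * (M * exp (- (2 * g) * (T - 0))) * norm (\<phi> x))"
        using T by (intro mult_left_mono Hb) auto
      finally show ?thesis by (simp add: W_def mult_ac)
    qed
    then have "norm (\<integral>x. v 0 x \<bullet> H 0 x \<partial>unit_measure) \<le> (\<integral>x. M * exp (- (2 * g) * T) * (norm (W 0 x) * norm (\<phi> x)) \<partial>unit_measure)"
      by (intro norm_integral_le_dominated integrable_mult_right integrable_L2_product WL \<phi>) auto
    then show ?thesis by simp
  qed
  also have "\<dots> \<le> M * exp (- (2 * g) * T) * (L2norm (W 0) * L2norm \<phi>)"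
    unfolding integral_mult_right_zero using M by (intro mult_left_mono L2_Cauchy_Schwarz WL \<phi>) auto
  also have "\<dots> \<le> M * exp (- g * T) * (L2norm (W 0) * L2norm \<phi>)"
    using M g T by (intro mult_right_mono mult_left_mono) auto
  finally have 1: "\<bar>\<integral>x. v 0 x \<bullet> H 0 x \<partial>unit_measure\<bar> \<le> M * exp (- g * T) * (L2norm (W 0) * L2norm \<phi>)" .
  define K where "K = M * Q * L2norm \<phi> * exp (- (2 * g) * T)"
  have K: "K \<ge> 0" using M Q by (simp add: K_def)
  have J: "norm (J t) \<le> K * exp (g * t)" if t: "t \<in> {0..T}" for t
  proof -
    have "norm (J t) \<le> M * exp (- (2 * g) * (T - t)) *
       (2 * exp k * (norm \<Omega>1 + norm \<Omega>2 + B) * (L2norm (\<alpha> t) + L2norm (\<beta> t)) + B / sqrt (2 * k) * L2norm (W t)) * L2norm \<phi>"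
      unfolding J_def W_def real_norm_def using t M by (intro forcing_estimate kb k L \<phi> Hb) auto
    also have "\<dots> \<le> M * exp (- (2 * g) * (T - t)) * (Q * exp (- g * t)) * L2norm \<phi>"
      using t M by (intro mult_right_mono mult_left_mono F) auto
    also have "\<dots> = M * Q * L2norm \<phi> * (exp (- (2 * g) * (T - t)) * exp (- g * t))" by simp
    also have "exp (- (2 * g) * (T - t)) * exp (- g * t) = exp (- (2 * g) * T) * exp (g * t)"
      by (simp add: exp_add[symmetric] algebra_simps)
    finally show ?thesis by (simp add: K_def)
  qed
  have "continuous_on {0..T} (\<lambda>t. K * exp (g * t))" by (intro continuous_intros)
  then have "integrable lborel (\<lambda>t. indicat_real {0..T} t *\<^sub>R (K * exp (g * t)))"
    by (intro borel_integrable_compact) auto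
  then have "set_integrable lebesgue {0..T} (\<lambda>t. K * exp (g * t))"
    unfolding set_integrable_def by (subst integrable_completion) auto
  note Ki = this
  have "norm (LINT t:{0..T}|lebesgue. J t) \<le> (LINT t:{0..T}|lebesgue. K * exp (g * t))"
    by (rule norm_set_integral_le_dominated[OF Ki J])
  also have "\<dots> = integral {0..T} (\<lambda>t. K * exp (g * t))"
    by (rule set_lebesgue_integral_eq_integral(2)[OF Ki])
  also have "integral {0..T} (\<lambda>t. K * exp (g * t)) = K * exp (g * T) / g - K * exp (g * 0) / g"
    by (intro integral_unique fundamental_theorem_of_calculus)
       (use T g in \<open>auto intro!: derivative_eq_intros simp: has_real_derivative_iff_has_vector_derivative[symmetric]\<close>)
  also have "\<dots> \<le> K * exp (g * T) / g" using K g by simp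
  also have "\<dots> = M * Q / g * L2norm \<phi> * exp (- g * T)"
    by (simp add: K_def exp_add[symmetric])
  finally have 2: "\<bar>LINT t:{0..T}|lebesgue. J t\<bar> \<le> M * Q / g * L2norm \<phi> * exp (- g * T)" by simp
  have "\<bar>\<integral>x. W T x \<bullet> \<phi> x \<partial>unit_measure\<bar> \<le> M * exp (- g * T) * (L2norm (W 0) * L2norm \<phi>) + M * Q / g * L2norm \<phi> * exp (- g * T)"
    using I 1 2 by linarith
  also have "\<dots> = exp (- g * T) * (M * L2norm (W 0) + M * Q / g) * L2norm \<phi>" by (simp add: algebra_simps)
  finally show "\<bar>\<integral>x. W T x \<bullet> (bump x *\<^sub>R p x) \<partial>unit_measure\<bar>
     \<le> exp (- g * T) * (M * L2norm (W 0) + M * Q / g) * L2norm (\<lambda>x. bump x *\<^sub>R p x)"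
    by (simp only: \<phi>_def)
qed

lemma L2_path_bounded:
  assumes "L2_path f"
  obtains b where "\<And>t. 0 \<le> t \<Longrightarrow> t \<le> T \<Longrightarrow> L2norm (f t) \<le> b"
proof -
  have "continuous_on {0..T} (\<lambda>t. L2norm (f t))"
    unfolding continuous_on_def
  proof
    fix t assume t: "t \<in> {0..T}"
    have L: "in_L2 (f s)" if "s \<in> {0..T}" for s using assms that by (auto simp: L2_path_def)
    have "((\<lambda>s. L2norm (f s) - L2norm (f t)) \<longlongrightarrow> 0) (at t within {0..T})"
    proof (rule Lim_null_comparison)
      show "((\<lambda>s. L2norm (\<lambda>x. f s x - f t x)) \<longlongrightarrow> 0) (at t within {0..T})"
        using assms t by (auto simp: L2_path_def intro: tendsto_within_subset)
      have "norm (L2norm (f s) - L2norm (f t)) \<le> L2norm (\<lambda>x. f s x - f t x)" if "s \<in> {0..T}" for s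
        using L2norm_triangle[OF L[OF that] L[OF t]] L2norm_triangle[OF L[OF t] L[OF that]]
        by (simp add: L2norm_def norm_minus_commute abs_if)
      then show "\<forall>\<^sub>F s in at t within {0..T}. norm (L2norm (f s) - L2norm (f t)) \<le> L2norm (\<lambda>x. f s x - f t x)"
        by (auto simp: eventually_at_filter)
    qed
    then show "((\<lambda>s. L2norm (f s)) \<longlongrightarrow> L2norm (f t)) (at t within {0..T})"
      by (simp add: LIM_zero_iff)
  qed
  then have "bounded ((\<lambda>t. L2norm (f t)) ` {0..T})"
    by (intro compact_imp_bounded compact_continuous_image) auto
  then obtain b where "\<forall>t\<in>{0..T}. norm (L2norm (f t)) \<le> b" by (auto simp: bounded_iff)
  then show thesis by (intro that[of b]) auto
qed

text \<open>Let \<open>S\<close> be the supremum of \<open>exp (g * s) * \<parallel>W s\<parallel>\<close> over \<open>{0..t}\<close>, which is finite by continuity in time.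
Using \<open>S\<close> to bound the Volterra forcing in \<open>v_duhamel_bound\<close> gives \<open>S \<le> A + S / 2\<close>, where \<open>A\<close>
depends on the data only; hence \<open>S \<le> 2 A\<close>.\<close>

lemma v_decay:
  fixes \<Psi> :: "real^'n^'n" and z :: "'n \<Rightarrow> real \<Rightarrow> real^'n"
  assumes sol: "target_solution lam1 lam2 \<rho> \<Omega>1 \<Omega>2 \<Psi> N1 N2 N3 \<alpha> \<beta> v"
    and kb: "kernels_bounded_by B N1 N2 N3" and k: "k > 0"
    and M: "M > 0" and g: "g > 0"
    and z0: "\<And>i. z i 0 = axis i 1"
    and zd: "\<And>i t. t \<ge> 0 \<Longrightarrow> (z i has_vector_derivative z i t v* \<Psi>) (at t within {0..})"
    and zb: "\<And>t w. t \<ge> 0 \<Longrightarrow> norm (\<Sum>i\<in>UNIV. w $ i *\<^sub>R z i t) \<le> M * exp (- (2 * g) * t) * norm w"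
    and small: "M / g * (B / sqrt (2 * k)) \<le> 1 / 2"
    and P: "\<And>t. t \<ge> 0 \<Longrightarrow> 2 * exp k * (norm \<Omega>1 + norm \<Omega>2 + B) * (L2norm (\<alpha> t) + L2norm (\<beta> t)) \<le> P * exp (- g * t)"
    and t: "t \<ge> 0"
  shows "L2norm (v t) \<le> exp (- g * t) * (2 * ((M + 1) * exp k * L2norm (v 0) + M * P / g))"
proof -
  note L = target_solution_in_L2[OF sol]
  define W where "W = (\<lambda>t x. exp (k * x) *\<^sub>R v t x)"
  have WL: "in_L2 (W t)" if "t \<ge> 0" for t
    unfolding W_def by (intro in_L2_scaleR_continuous continuous_intros L that)
  have Wle: "L2norm (W t) \<le> exp k * L2norm (v t)" if "t \<ge> 0" for t
  proof -
    have "in_L2 (\<lambda>x. exp k *\<^sub>R v t x)" by (intro in_L2_scaleR_continuous continuous_intros L that)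
    then have "L2norm (W t) \<le> L2norm (\<lambda>x. exp k *\<^sub>R v t x)"
      by (rule L2norm_mono[OF _ WL[OF that]]) (use k in \<open>auto simp: W_def intro!: mult_right_mono\<close>)
    also have "\<dots> = exp k * L2norm (v t)"
      by (simp add: L2norm_eq power_mult_distrib real_sqrt_mult)
    finally show ?thesis .
  qed
  have leW: "L2norm (v t) \<le> L2norm (W t)" if "t \<ge> 0" for t
    by (rule L2norm_mono[OF WL L(3)]) (use k that in \<open>auto simp: W_def mult_le_cancel_right1\<close>)
  have "L2_path v" using sol by (simp add: target_solution_def)
  then obtain b where b: "\<And>s. 0 \<le> s \<Longrightarrow> s \<le> t \<Longrightarrow> L2norm (v s) \<le> b" using L2_path_bounded by blast
  define w where "w = (\<lambda>s. exp (g * s) * L2norm (W s))"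
  have ew: "exp (- g * s) * w s = L2norm (W s)" for s
    unfolding w_def mult.assoc[symmetric] exp_add[symmetric] by simp
  define S where "S = (SUP s\<in>{0..t}. w s)"
  have bdd: "bdd_above (w ` {0..t})"
  proof (rule bdd_aboveI2)
    fix s assume s: "s \<in> {0..t}"
    have "L2norm (W s) \<le> exp k * b" using Wle[of s] b[of s] s by (meson atLeastAtMost_iff exp_ge_zero mult_left_mono order_trans)
    then show "w s \<le> exp (g * t) * (exp k * b)" unfolding w_def using s g by (intro mult_mono) auto
  qed
  have wS: "w s \<le> S" if "s \<in> {0..t}" for s unfolding S_def by (rule cSUP_upper[OF that bdd])
  let ?A = "(M + 1) * L2norm (W 0) + M * P / g"
  have P0: "P \<ge> 0"
  proof -
    have "0 \<le> 2 * exp k * (norm \<Omega>1 + norm \<Omega>2 + B) * (L2norm (\<alpha> 0) + L2norm (\<beta> 0))"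
      using kb by (intro mult_nonneg_nonneg) (auto simp: kernels_bounded_by_def)
    from order_trans[OF this P[of 0]] show ?thesis by simp
  qed
  have B: "B \<ge> 0" using kb by (simp add: kernels_bounded_by_def)
  have S0: "S \<ge> 0" using wS[of 0] t by (simp add: w_def order_trans[OF L2norm_nonneg])
  have "w s \<le> ?A + S / 2" if s: "s \<in> {0..t}" for s
  proof (cases "s = 0")
    case True
    then show ?thesis using M g P0 S0 by (simp add: w_def algebra_simps)
  next
    case False
    let ?Q = "P + B / sqrt (2 * k) * S"
    have "L2norm (W s) \<le> exp (- g * s) * (M * L2norm (W 0) + M * ?Q / g)"
      unfolding W_def
    proof (rule v_duhamel_bound[OF sol _ kb k M g z0 zd zb])
      fix r assume r: "0 \<le> r" "r \<le> s"
      have "exp (- g * r) * w r \<le> exp (- g * r) * S" using r s by (intro mult_left_mono wS) auto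
      then have "L2norm (W r) \<le> S * exp (- g * r)"
        by (simp only: ew mult.commute[of S])
      then have "B / sqrt (2 * k) * L2norm (W r) \<le> B / sqrt (2 * k) * (S * exp (- g * r))"
        using B k by (intro mult_left_mono) auto
      then show "2 * exp k * (norm \<Omega>1 + norm \<Omega>2 + B) * (L2norm (\<alpha> r) + L2norm (\<beta> r)) +
          B / sqrt (2 * k) * L2norm (\<lambda>x. exp (k * x) *\<^sub>R v r x) \<le> ?Q * exp (- g * r)"
        using P[OF r(1)] by (simp add: W_def algebra_simps)
    qed (use s False in auto)
    then have "w s \<le> exp (g * s) * (exp (- g * s) * (M * L2norm (W 0) + M * ?Q / g))"
      unfolding w_def by (intro mult_left_mono) auto
    also have "\<dots> = M * L2norm (W 0) + M * ?Q / g"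
      unfolding mult.assoc[symmetric] exp_add[symmetric] by simp
    also have "\<dots> = M * L2norm (W 0) + M * P / g + M / g * (B / sqrt (2 * k)) * S"
      by (simp add: algebra_simps add_divide_distrib)
    also have "\<dots> \<le> M * L2norm (W 0) + M * P / g + 1 / 2 * S"
      by (intro add_left_mono mult_right_mono small S0)
    also have "\<dots> \<le> ?A + S / 2" by (simp add: algebra_simps)
    finally show ?thesis .
  qed
  then have "S \<le> ?A + S / 2" unfolding S_def using t by (intro cSUP_least) auto
  then have "w t \<le> 2 * ?A" using wS[of t] t by simp
  then have "exp (- g * t) * w t \<le> exp (- g * t) * (2 * ?A)" by (intro mult_left_mono) auto
  then have "L2norm (W t) \<le> exp (- g * t) * (2 * ?A)"
    by (simp only: ew)
  also have "\<dots> \<le> exp (- g * t) * (2 * ((M + 1) * (exp k * L2norm (v 0)) + M * P / g))"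
    using M by (intro mult_left_mono add_right_mono Wle) auto
  finally show ?thesis using leW[OF t] by (simp add: mult.assoc)
qed

lemma exponentially_stable_bounded_kernels:
  fixes \<Psi> :: "real^'n^'n"
  assumes lam: "lam1 > 0" "lam2 > 0" and hur: "hurwitz \<Psi>" and kb: "kernels_bounded_by B N1 N2 N3"
  shows "exponentially_stable_L2 (target_solution lam1 lam2 \<rho> \<Omega>1 \<Omega>2 \<Psi> N1 N2 N3)"
proof -
  obtain z :: "'n \<Rightarrow> real \<Rightarrow> real^'n" and M c where c: "c > 0" and M: "M > 0" and z0: "\<And>i. z i 0 = axis i 1"
    and zd: "\<And>i t. t \<ge> 0 \<Longrightarrow> (z i has_vector_derivative z i t v* \<Psi>) (at t within {0..})"
    and zb: "\<And>t w. t \<ge> 0 \<Longrightarrow> norm (\<Sum>i\<in>UNIV. w $ i *\<^sub>R z i t) \<le> M * exp (- c * t) * norm w"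
    by (rule hurwitz_transpose_semigroup[OF hur]) (rule that; assumption)
  define g where "g = c / 2"
  have g: "g > 0" and c2: "c = 2 * g" using c by (auto simp: g_def)
  have B: "B \<ge> 0" using kb by (simp add: kernels_bounded_by_def)
  \<comment> \<open>With \<open>r = sqrt (2 * k)\<close>, the smallness condition of \<open>v_decay\<close> reads
    \<open>2 * M * B \<le> g * r\<close>.\<close>
  define r where "r = 2 * M * B / g + 1"
  have r: "r > 0" using M B g by (simp add: r_def add_nonneg_pos)
  define k where "k = r\<^sup>2 / 2"
  have k: "k > 0" and sk: "sqrt (2 * k) = r" using r by (auto simp: k_def)
  have small: "M / g * (B / sqrt (2 * k)) \<le> 1 / 2"
    unfolding sk using r g by (simp add: r_def field_simps)
  define a1 where "a1 = exp (g * (1 / lam1))"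
  define b1 where "b1 = exp (g * (1 / lam1 + 1 / lam2))"
  define q where "q = \<bar>lam2 * \<rho> / lam1\<bar> / sqrt (lam2 / lam1)"
  define D where "D = 2 * exp k * (norm \<Omega>1 + norm \<Omega>2 + B)"
  have q: "q \<ge> 0" using lam by (simp add: q_def)
  have D: "D \<ge> 0" using B by (simp add: D_def)
  have ab: "a1 > 0" "b1 > 0" by (auto simp: a1_def b1_def)
  define A where "A = a1 + b1 * q + b1"
  have A: "A > 0" using ab q by (simp add: A_def add_pos_nonneg add_nonneg_pos)
  define C where "C = A + 2 * ((M + 1) * exp k + M * (D * A) / g)"
  have C: "C > 0" unfolding C_def using A M D g by (intro add_pos_nonneg) auto
  have "L2norm (\<alpha> t) + L2norm (\<beta> t) + L2norm (v t) \<le> C * exp (- g * t) * (L2norm (\<alpha> 0) + L2norm (\<beta> 0) + L2norm (v 0))"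
    if sol: "target_solution lam1 lam2 \<rho> \<Omega>1 \<Omega>2 \<Psi> N1 N2 N3 \<alpha> \<beta> v" and t: "t \<ge> 0" for \<alpha> \<beta> v t
  proof -
    define s where "s = L2norm (\<alpha> 0) + L2norm (\<beta> 0)"
    define S where "S = s + L2norm (v 0)"
    have s: "s \<ge> 0" "s \<le> S" "L2norm (v 0) \<le> S" "S \<ge> 0" by (simp_all add: s_def S_def)
    have ab_decay: "L2norm (\<alpha> t) + L2norm (\<beta> t) \<le> A * s * exp (- g * t)" if "t \<ge> 0" for t
    proof -
      have "L2norm (\<alpha> t) + L2norm (\<beta> t) \<le> a1 * exp (- g * t) * L2norm (\<alpha> 0)
          + b1 * exp (- g * t) * (q * L2norm (\<alpha> 0) + L2norm (\<beta> 0))"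
        unfolding a1_def b1_def q_def by (intro add_mono alpha_decay[OF sol] beta_decay[OF sol] lam g that)
      also have "\<dots> \<le> a1 * exp (- g * t) * s + b1 * exp (- g * t) * (q * s + s)"
        using ab q by (intro add_mono mult_left_mono) (auto simp: s_def)
      also have "\<dots> = A * s * exp (- g * t)" by (simp add: A_def algebra_simps)
      finally show ?thesis .
    qed
    have "L2norm (v t) \<le> exp (- g * t) * (2 * ((M + 1) * exp k * L2norm (v 0) + M * (D * (A * s)) / g))"
    proof (rule v_decay[OF sol kb k M g z0 zd zb[unfolded c2] small _ t])
      fix t :: real assume "t \<ge> 0"
      from mult_left_mono[OF ab_decay[OF this] D]
      show "2 * exp k * (norm \<Omega>1 + norm \<Omega>2 + B) * (L2norm (\<alpha> t) + L2norm (\<beta> t)) \<le> D * (A * s) * exp (- g * t)"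
        by (simp add: D_def mult.assoc)
    qed
    also have "\<dots> \<le> exp (- g * t) * (2 * ((M + 1) * exp k * S + M * (D * (A * S)) / g))"
      using M g D A s by (intro mult_left_mono add_mono divide_right_mono) auto
    finally have "L2norm (v t) \<le> exp (- g * t) * (2 * ((M + 1) * exp k * S + M * (D * (A * S)) / g))" .
    moreover have "A * s * exp (- g * t) \<le> A * S * exp (- g * t)"
      using A s by (intro mult_right_mono mult_left_mono) auto
    ultimately have "L2norm (\<alpha> t) + L2norm (\<beta> t) + L2norm (v t)
        \<le> A * S * exp (- g * t) + exp (- g * t) * (2 * ((M + 1) * exp k * S + M * (D * (A * S)) / g))"
      using ab_decay[OF t] by linarith
    also have "\<dots> = C * exp (- g * t) * S" by (simp add: C_def algebra_simps)
    finally show ?thesis by (simp add: S_def s_def)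
  qed
  then show ?thesis unfolding exponentially_stable_L2_def using C g by blast
qed

lemma inverse_kernels_bounded:
  fixes \<Omega>1 \<Omega>2 :: "real^'n"
  assumes inv: "inverse_kernels K1 K2 G Q1 Q2 R L1 L2 S M1 M2 E"
    and N1: "\<forall>(x, \<xi>)\<in>kernel_domain. N1 x \<xi> = L1 x \<xi> *\<^sub>R \<Omega>1 + M1 x \<xi> *\<^sub>R \<Omega>2"
    and N2: "\<forall>(x, \<xi>)\<in>kernel_domain. N2 x \<xi> = L2 x \<xi> *\<^sub>R \<Omega>1 + M2 x \<xi> *\<^sub>R \<Omega>2"
    and N3: "\<forall>(x, \<xi>)\<in>kernel_domain. N3 x \<xi> = outer \<Omega>1 (S x \<xi>) + outer \<Omega>2 (E x \<xi>)"
  obtains B where "kernels_bounded_by B N1 N2 N3"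
proof -
  have ex: "\<exists>b. \<forall>x y. (x, y) \<in> kernel_domain \<longrightarrow> norm (F x y) \<le> b" if "bounded_kernel F"
    for F :: "real \<Rightarrow> real \<Rightarrow> 'c::euclidean_space"
    using that by (fastforce simp: bounded_kernel_def bounded_iff)
  have bk: "bounded_kernel L1" "bounded_kernel L2" "bounded_kernel M1" "bounded_kernel M2" "bounded_kernel S" "bounded_kernel E"
    using inv by (simp_all only: inverse_kernels_def)
  obtain l1 where l1: "\<And>x y. (x, y) \<in> kernel_domain \<Longrightarrow> norm (L1 x y) \<le> l1" 
    using ex[OF bk(1)] by blast
  obtain l2 where l2: "\<And>x y. (x, y) \<in> kernel_domain \<Longrightarrow> norm (L2 x y) \<le> l2" 
    using ex[OF bk(2)] by blast
  obtain m1 where m1: "\<And>x y. (x, y) \<in> kernel_domain \<Longrightarrow> norm (M1 x y) \<le> m1" 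
    using ex[OF bk(3)] by blast
  obtain m2 where m2: "\<And>x y. (x, y) \<in> kernel_domain \<Longrightarrow> norm (M2 x y) \<le> m2" 
    using ex[OF bk(4)] by blast
  obtain s where s: "\<And>x y. (x, y) \<in> kernel_domain \<Longrightarrow> norm (S x y) \<le> s" 
    using ex[OF bk(5)] by blast
  obtain e where e: "\<And>x y. (x, y) \<in> kernel_domain \<Longrightarrow> norm (E x y) \<le> e" 
    using ex[OF bk(6)] by blast
  define b where "b = Max {l1, l2, m1, m2, s, e}"
  have b: "norm (L1 x y) \<le> b" "norm (L2 x y) \<le> b" "norm (M1 x y) \<le> b" "norm (M2 x y) \<le> b" "norm (S x y) \<le> b" "norm (E x y) \<le> b"
    if "(x, y) \<in> kernel_domain" for x y
    using l1[OF that] l2[OF that] m1[OF that] m2[OF that] s[OF that] e[OF that] unfolding b_def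
    by (auto elim!: order_trans intro!: Max_ge simp del: Max_insert real_norm_def)
  have b0: "b \<ge> 0" using b(1)[of 0 0] norm_ge_zero[of "L1 0 0"] by (auto simp: kernel_domain_def)
  let ?B = "b * norm \<Omega>1 + b * norm \<Omega>2"
  have outer: "outer a c *v w = (c \<bullet> w) *\<^sub>R a" for a c w :: "real^'n"
    by (simp add: outer_def matrix_vector_mult_def vec_eq_iff inner_vec_def sum_distrib_left mult_ac)
  have lin: "norm (p *\<^sub>R \<Omega>1 + q *\<^sub>R \<Omega>2) \<le> c * norm \<Omega>1 + c * norm \<Omega>2" if "\<bar>p\<bar> \<le> c" "\<bar>q\<bar> \<le> c" for p q c
    using that by (intro norm_triangle_le add_mono) (auto intro: mult_right_mono)
  show thesis
  proof (rule that[of ?B], unfold kernels_bounded_by_def, safe)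
    show "0 \<le> ?B" using b0 by simp
    fix x y assume xy: "(x, y) \<in> kernel_domain"
    show "norm (N1 x y) \<le> ?B" using N1 xy lin b(1,3)[OF xy] by fastforce
    show "norm (N2 x y) \<le> ?B" using N2 xy lin b(2,4)[OF xy] by fastforce
    fix w :: "real^'n"
    have in_le: "\<bar>c \<bullet> w\<bar> \<le> b * norm w" if "norm c \<le> b" for c
      by (rule order_trans[OF Cauchy_Schwarz_ineq2]) (intro mult_right_mono that norm_ge_zero)
    have "N3 x y *v w = (S x y \<bullet> w) *\<^sub>R \<Omega>1 + (E x y \<bullet> w) *\<^sub>R \<Omega>2"
      using N3 xy by (auto simp: matrix_vector_mult_add_rdistrib outer)
    then show "norm (N3 x y *v w) \<le> ?B * norm w"
      using lin[OF in_le[OF b(5)[OF xy]] in_le[OF b(6)[OF xy]]] by (simp add: algebra_simps)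
  qed
qed

theorem lemma3p3:
  fixes lam1 lam2 \<rho> q \<sigma>12 \<sigma>21 :: real
    and \<Theta>1 \<Theta>2 \<Omega>1 \<Omega>2 :: "real^'n"
    and \<Psi> :: "real^'n^'n"
    and K1 K2 Q1 Q2 L1 L2 M1 M2 :: "real \<Rightarrow> real \<Rightarrow> real"
    and G R S E N1 N2 :: "real \<Rightarrow> real \<Rightarrow> real^'n"
    and N3 :: "real \<Rightarrow> real \<Rightarrow> real^'n^'n"
  assumes "lam1 > 0" and "lam2 > 0" and "\<rho> \<noteq> 0" and "q \<noteq> 0"
    and "hurwitz \<Psi>"
    and "backstepping_kernels lam1 lam2 \<rho> \<sigma>12 \<sigma>21 \<Theta>1 \<Theta>2 \<Omega>1 \<Omega>2 \<Psi> K1 K2 G Q1 Q2 R"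
    and "inverse_kernels K1 K2 G Q1 Q2 R L1 L2 S M1 M2 E"
    and "\<forall>(x, \<xi>)\<in>kernel_domain. N1 x \<xi> = L1 x \<xi> *\<^sub>R \<Omega>1 + M1 x \<xi> *\<^sub>R \<Omega>2"
    and "\<forall>(x, \<xi>)\<in>kernel_domain. N2 x \<xi> = L2 x \<xi> *\<^sub>R \<Omega>1 + M2 x \<xi> *\<^sub>R \<Omega>2"
    and "\<forall>(x, \<xi>)\<in>kernel_domain. N3 x \<xi> = outer \<Omega>1 (S x \<xi>) + outer \<Omega>2 (E x \<xi>)"
  shows "exponentially_stable_L2 (target_solution lam1 lam2 \<rho> \<Omega>1 \<Omega>2 \<Psi> N1 N2 N3)"
proof -
  obtain B where "kernels_bounded_by B N1 N2 N3"
    using inverse_kernels_bounded[OF assms(7-10)] .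
  then show ?thesis by (rule exponentially_stable_bounded_kernels[OF assms(1,2,5)])
qed

end
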